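(* Let $(\mathcal{X},d)$ be a finite metric space and let $\lambda_x>0$ be an arrival rate for each $x\in\mathcal{X}$. For MPMD in the Poisson arrival model with these rates, the Greedy algorithm achieves a ratio of expectations of $16/(1-e^{-2})$, i.e. $$\limsup_{m\to\infty}\frac{\mathbb{E}^m_\sigma[\mathrm{Greedy}(\sigma)]}{\mathbb{E}^m_\sigma[\mathrm{OPT}(\sigma)]}\le \frac{16}{1-e^{-2}}.$$
   Context: MPMD (Min-cost Perfect Matching with Delays) on a finite metric space $(\mathcal{X},d)$: the input is a sequence $\sigma$ of $m$ requests ($m$ even), each request $r$ having a location $\ell(r)\in\mathcal{X}$ and an arrival time $t(r)\ge 0$ (all distinct). A solution partitions the requests into pairs and assigns to each request a matching time $s(r)\ge t(r)$, with $s(r)=s(r')$ for matched pairs $(r,r')$ (so $s(r)\ge\max\{t(r),t(r')\}$). Its cost is $\sum_{(r,r')\text{ matched}} d(\ell(r),\ell(r'))+\sum_{r}(s(r)-t(r))$. An online algorithm decides at time $t$ to match a pair using only the requests arrived by time $t$, and decisions are irrevocable. $\mathrm{OPT}(\sigma)$ is the minimum cost of any (offline) solution. Poisson arrival model: for each $x\in\mathcal{X}$ requests arrive at $x$ according to independent Poisson processes of rate $\lambda_x>0$; equivalently, the waiting times between consecutive requests (over the whole space) are i.i.d. exponential with parameter $\lambda(\mathcal{X}):=\sum_{x\in\mathcal{X}}\lambda_x$ and each request is located at $x$ independently with probability $\lambda_x/\lambda(\mathcal{X})$, independently of the waiting times. A random sequence of length $m$ consists of $m$ requests generated this way; $\mathbb{E}^m_\sigma$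 denotes expectation over it. The Greedy algorithm: at any time $t$, if there exist two pending (unmatched, already arrived) requests $r,r'$ with $(t-t(r))+(t-t(r'))\ge d(\ell(r),\ell(r'))$, match them (ties broken arbitrarily). *)

theory Defs
  imports "HOL-Probability.Probability"
begin

text \<open>A request sequence is a list of (location, arrival time); requests are referred to by their
  position in the list.\<close>

type_synonym 'a requests = "('a \<times> real) list"

abbreviation loc :: "'a requests \<Rightarrow> nat \<Rightarrow> 'a" where
  "loc \<sigma> i \<equiv> fst (\<sigma> ! i)"

abbreviation arr :: "'a requests \<Rightarrow> nat \<Rightarrow> real" where
  "arr \<sigma> i \<equiv> snd (\<sigma> ! i)"

definition mpmd_input :: "'a set \<Rightarrow> 'a requests \<Rightarrow> bool" where
  "mpmd_input X \<sigma> \<longleftrightarrow>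
     even (length \<sigma>) \<and> (\<forall>i < length \<sigma>. loc \<sigma> i \<in> X \<and> 0 \<le> arr \<sigma> i) \<and>
     inj_on (arr \<sigma>) {..<length \<sigma>}"

text \<open>A pair of matched requests is represented once, with the smaller index first.\<close>

definition perfect_matching_on :: "nat set \<Rightarrow> (nat \<times> nat) set \<Rightarrow> bool" where
  "perfect_matching_on U M \<longleftrightarrow>
     M \<subseteq> {(i, j). i \<in> U \<and> j \<in> U \<and> i < j} \<and>
     (\<forall>k \<in> U. \<exists>!p. p \<in> M \<and> (k = fst p \<or> k = snd p))"

text \<open>A solution consists of the matched pairs and the matching times.\<close>

type_synonym solution = "(nat \<times> nat) set \<times> (nat \<Rightarrow> real)"

definition mpmd_solution :: "'a requests \<Rightarrow> solution \<Rightarrow> bool" where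
  "mpmd_solution \<sigma> = (\<lambda>(M, s).
     perfect_matching_on {..<length \<sigma>} M \<and>
     (\<forall>i < length \<sigma>. arr \<sigma> i \<le> s i) \<and>
     (\<forall>(i, j) \<in> M. s i = s j))"

definition mpmd_cost :: "('a \<Rightarrow> 'a \<Rightarrow> real) \<Rightarrow> 'a requests \<Rightarrow> solution \<Rightarrow> real" where
  "mpmd_cost d \<sigma> = (\<lambda>(M, s).
     (\<Sum>(i, j) \<in> M. d (loc \<sigma> i) (loc \<sigma> j)) + (\<Sum>i < length \<sigma>. s i - arr \<sigma> i))"

text \<open>The infimum is a minimum, see \<open>OPT_attained\<close> and \<open>OPT_le\<close> below.\<close>

definition OPT :: "('a \<Rightarrow> 'a \<Rightarrow> real) \<Rightarrow> 'a requests \<Rightarrow> real" where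
  "OPT d \<sigma> = (INF S \<in> {S. mpmd_solution \<sigma> S}. mpmd_cost d \<sigma> S)"

text \<open>The solutions that Greedy may output, over all ways of breaking ties: a pair is matched only
  when its joint waiting time has reached its distance, and once the matches of time \<open>\<tau>\<close> have been
  made, no two requests that are still pending meet this condition at time \<open>\<tau>\<close>.\<close>

definition greedy_solution :: "('a \<Rightarrow> 'a \<Rightarrow> real) \<Rightarrow> 'a requests \<Rightarrow> solution \<Rightarrow> bool" where
  "greedy_solution d \<sigma> = (\<lambda>(M, s).
     mpmd_solution \<sigma> (M, s) \<and>
     (\<forall>(i, j) \<in> M. (s i - arr \<sigma> i) + (s j - arr \<sigma> j) \<ge> d (loc \<sigma> i) (loc \<sigma> j)) \<and>
     (\<forall>\<tau>. \<not> (\<exists>i < length \<sigma>. \<exists>j < length \<sigma>. i \<noteq> j \<and>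
        arr \<sigma> i \<le> \<tau> \<and> \<tau> < s i \<and> arr \<sigma> j \<le> \<tau> \<and> \<tau> < s j \<and>
        (\<tau> - arr \<sigma> i) + (\<tau> - arr \<sigma> j) \<ge> d (loc \<sigma> i) (loc \<sigma> j))))"

text \<open>Poisson arrivals: \<open>fst (\<omega> i)\<close> is the waiting time before request \<open>i\<close>, \<open>snd (\<omega> i)\<close> its
  location.\<close>

definition poisson_arrivals :: "'a set \<Rightarrow> ('a \<Rightarrow> real) \<Rightarrow> nat \<Rightarrow> (nat \<Rightarrow> real \<times> 'a) measure" where
  "poisson_arrivals X rate m =
     (\<Pi>\<^sub>M i\<in>{..<m}. density lborel (\<lambda>w. ennreal (exponential_density (\<Sum>x\<in>X. rate x) w)) \<Otimes>\<^sub>M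
        point_measure X (\<lambda>x. ennreal (rate x / (\<Sum>y\<in>X. rate y))))"

definition request_seq :: "nat \<Rightarrow> (nat \<Rightarrow> real \<times> 'a) \<Rightarrow> 'a requests" where
  "request_seq m \<omega> = map (\<lambda>i. (snd (\<omega> i), \<Sum>j\<le>i. fst (\<omega> j))) [0..<m]"

text \<open>Breaking ties differently changes the Greedy cost on a null set only, but may make it
  non-measurable. The nonnegative integral gives the same value as over the completed measure
  (\<open>nn_integral_completion\<close>), hence is the expectation of the Greedy cost for every tie-breaking
  rule.\<close>

definition expected :: "'a set \<Rightarrow> ('a \<Rightarrow> real) \<Rightarrow> nat \<Rightarrow> ('a requests \<Rightarrow> real) \<Rightarrow> ennreal" where
  "expected X rate m f =
     (\<integral>\<^sup>+ \<omega>. ennreal (f (request_seq m \<omega>)) \<partial>poisson_arrivals X rate m)"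

lemma prob_space_poisson_arrivals:
  assumes "finite X" "X \<noteq> {}" "\<And>x. x \<in> X \<Longrightarrow> rate x > 0"
  shows "prob_space (poisson_arrivals X rate m)"
proof -
  have pos: "(\<Sum>x\<in>X. rate x) > 0"
    using assms by (simp add: sum_pos)
  have "(\<Sum>x\<in>X. rate x / (\<Sum>y\<in>X. rate y)) = 1"
    using pos by (simp flip: sum_divide_distrib)
  then have "prob_space (point_measure X (\<lambda>x. ennreal (rate x / (\<Sum>y\<in>X. rate y))))"
    using assms pos by (intro prob_space_point_measure) (auto simp: less_imp_le)
  then show ?thesis
    unfolding poisson_arrivals_def
    using prob_space_exponential_density[OF pos] by (intro prob_space_PiM prob_space_pair) auto
qed

lemma perfect_matching_on_insert:
  assumes M: "perfect_matching_on (U - {i, j}) M" and ij: "i \<in> U" "j \<in> U" "i < j"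
  shows "perfect_matching_on U (insert (i, j) M)"
proof -
  have sub: "M \<subseteq> {(a, b). a \<in> U - {i, j} \<and> b \<in> U - {i, j} \<and> a < b}"
    and ex: "\<And>k. k \<in> U - {i, j} \<Longrightarrow> \<exists>!p. p \<in> M \<and> (k = fst p \<or> k = snd p)"
    using M by (auto simp: perfect_matching_on_def)
  have "\<exists>!p. p \<in> insert (i, j) M \<and> (k = fst p \<or> k = snd p)" if "k \<in> U" for k
  proof (cases "k = i \<or> k = j")
    case True
    then show ?thesis using sub by (intro ex1I[of _ "(i, j)"]) auto
  next
    case False
    then have "\<exists>!p. p \<in> M \<and> (k = fst p \<or> k = snd p)"
      using that by (intro ex) auto
    moreover have "p \<in> insert (i, j) M \<and> (k = fst p \<or> k = snd p) \<longleftrightarrow>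
        p \<in> M \<and> (k = fst p \<or> k = snd p)" for p
      using False by auto
    ultimately show ?thesis by simp
  qed
  then show ?thesis using sub ij by (auto simp: perfect_matching_on_def)
qed

text \<open>Greedy always produces a solution: among the unmatched requests (arrived or not), repeatedly
  match the pair whose joint waiting time reaches its distance first.\<close>

lemma greedy_solution_exists:
  assumes sym: "\<And>x y. d x y = d y x" and "even (length \<sigma>)"
  shows "\<exists>S. greedy_solution d \<sigma> S"
proof -
  define D where "D i j = d (loc \<sigma> i) (loc \<sigma> j)" for i j
  define T where "T i j = Max {arr \<sigma> i, arr \<sigma> j, (arr \<sigma> i + arr \<sigma> j + D i j) / 2}" for i j
  have Dsym: "D i j = D j i" for i j using sym by (simp add: D_def)
  have Tsym: "T i j = T j i" for i j
    by (simp add: T_def Dsym[of i j] insert_commute add.commute)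
  have "\<exists>M s. perfect_matching_on U M \<and> (\<forall>i\<in>U. arr \<sigma> i \<le> s i) \<and> (\<forall>(i, j) \<in> M. s i = s j) \<and>
      (\<forall>(i, j) \<in> M. (s i - arr \<sigma> i) + (s j - arr \<sigma> j) \<ge> D i j) \<and>
      (\<forall>\<tau>. \<forall>i\<in>U. \<forall>j\<in>U. i \<noteq> j \<longrightarrow> arr \<sigma> i \<le> \<tau> \<longrightarrow> \<tau> < s i \<longrightarrow> arr \<sigma> j \<le> \<tau> \<longrightarrow> \<tau> < s j \<longrightarrow>
         (\<tau> - arr \<sigma> i) + (\<tau> - arr \<sigma> j) < D i j)"
    if "finite U" "even (card U)" for U
    using that
  proof (induction "card U" arbitrary: U rule: less_induct)
    case less
    show ?case
    proof (cases "U = {}")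
      case True
      then show ?thesis by (intro exI[of _ "{}"]) (auto simp: perfect_matching_on_def)
    next
      case False
      define Q where "Q = {(i, j). i \<in> U \<and> j \<in> U \<and> i < j}"
      have "Q \<subseteq> U \<times> U" by (auto simp: Q_def)
      then have finQ: "finite Q" using less.prems(1) by (meson finite_SigmaI finite_subset)
      have "card U \<noteq> 0" "card U \<noteq> 1" using False less.prems by auto
      then have "card U \<ge> 2" by linarith
      then obtain a b where ab: "a \<in> U" "b \<in> U" "a \<noteq> b"
        by (metis card_le_Suc0_iff_eq less.prems(1) not_less_eq_eq numeral_2_eq_2)
      then have "(min a b, max a b) \<in> Q" by (auto simp: Q_def min_def max_def)
      then have "\<exists>p\<in>Q. \<forall>q\<in>Q. case_prod T p \<le> case_prod T q"
        using finQ arg_min_if_finite(1)[OF finQ] arg_min_least[OF finQ]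
        by (metis empty_iff)
      then obtain i j where ij: "i \<in> U" "j \<in> U" "i < j"
        and least: "\<And>k l. (k, l) \<in> Q \<Longrightarrow> T i j \<le> T k l"
        by (fastforce simp: Q_def)
      have least': "T i j \<le> T k l" if "k \<in> U" "l \<in> U" "k \<noteq> l" for k l
        using least[of k l] least[of l k] Tsym[of k l] that
        by (cases "k < l") (auto simp: Q_def)
      have "card (U - {i, j}) = card U - 2"
        using ij less.prems by (simp add: card_Diff_subset)
      then obtain M s where M: "perfect_matching_on (U - {i, j}) M"
        and s: "\<forall>k\<in>U - {i, j}. arr \<sigma> k \<le> s k" "\<forall>(k, l) \<in> M. s k = s l"
          "\<forall>(k, l) \<in> M. (s k - arr \<sigma> k) + (s l - arr \<sigma> l) \<ge> D k l"
          "\<forall>\<tau>. \<forall>k\<in>U - {i, j}. \<forall>l\<in>U - {i, j}. k \<noteq> l \<longrightarrow> arr \<sigma> k \<le> \<tau> \<longrightarrow> \<tau> < s k \<longrightarrow>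
             arr \<sigma> l \<le> \<tau> \<longrightarrow> \<tau> < s l \<longrightarrow> (\<tau> - arr \<sigma> k) + (\<tau> - arr \<sigma> l) < D k l"
        using less.hyps[of "U - {i, j}"] less.prems \<open>card U \<ge> 2\<close> by auto
      define s' where "s' = s(i := T i j, j := T i j)"
      have s'_ij: "s' i = T i j" "s' j = T i j" by (auto simp: s'_def)
      have s'_else: "s' k = s k" if "k \<noteq> i" "k \<noteq> j" for k using that by (simp add: s'_def)
      have Mne: "k \<noteq> i \<and> k \<noteq> j \<and> l \<noteq> i \<and> l \<noteq> j" if "(k, l) \<in> M" for k l
        using M that by (auto simp: perfect_matching_on_def)
      have T_ge: "arr \<sigma> i \<le> T i j" "arr \<sigma> j \<le> T i j" "(arr \<sigma> i + arr \<sigma> j + D i j) / 2 \<le> T i j"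
        unfolding T_def by (intro Max_ge; simp)+
      have pend: "(\<tau> - arr \<sigma> k) + (\<tau> - arr \<sigma> l) < D k l"
        if "k \<in> U" "l \<in> U" "k \<noteq> l" "arr \<sigma> k \<le> \<tau>" "\<tau> < s' k" "arr \<sigma> l \<le> \<tau>" "\<tau> < s' l" for \<tau> k l
      proof (cases "k \<in> {i, j} \<or> l \<in> {i, j}")
        case True
        then have "\<tau> < T i j" using that s'_ij by auto
        also have "\<dots> \<le> T k l" using least' that by auto
        finally show ?thesis using that by (auto simp: T_def less_max_iff_disj)
      next
        case False
        then show ?thesis using s(4) that s'_else by auto
      qed
      show ?thesis
      proof (intro exI[of _ "insert (i, j) M"] exI[of _ s'] conjI)
        show "perfect_matching_on U (insert (i, j) M)"
          by (rule perfect_matching_on_insert[OF M ij])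
        show "\<forall>k\<in>U. arr \<sigma> k \<le> s' k" using s(1) T_ge by (auto simp: s'_def)
        show "\<forall>(k, l)\<in>insert (i, j) M. s' k = s' l"
          using s(2) Mne s'_else s'_ij by fastforce
        have "D k l \<le> s' k - arr \<sigma> k + (s' l - arr \<sigma> l)" if "(k, l) \<in> M" for k l
          using s(3) Mne[OF that] s'_else that by auto
        then show "\<forall>(k, l)\<in>insert (i, j) M. D k l \<le> s' k - arr \<sigma> k + (s' l - arr \<sigma> l)"
          using T_ge(3) s'_ij by (auto simp: field_simps)
        show "\<forall>\<tau>. \<forall>k\<in>U. \<forall>l\<in>U. k \<noteq> l \<longrightarrow> arr \<sigma> k \<le> \<tau> \<longrightarrow> \<tau> < s' k \<longrightarrow> arr \<sigma> l \<le> \<tau> \<longrightarrow> \<tau> < s' l \<longrightarrow>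
            (\<tau> - arr \<sigma> k) + (\<tau> - arr \<sigma> l) < D k l"
          using pend by blast
      qed
    qed
  qed
  from this[of "{..<length \<sigma>}"] assms(2) obtain M s where
    "perfect_matching_on {..<length \<sigma>} M" "\<forall>i<length \<sigma>. arr \<sigma> i \<le> s i" "\<forall>(i, j) \<in> M. s i = s j"
    "\<forall>(i, j) \<in> M. (s i - arr \<sigma> i) + (s j - arr \<sigma> j) \<ge> D i j"
    "\<forall>\<tau>. \<forall>i<length \<sigma>. \<forall>j<length \<sigma>. i \<noteq> j \<longrightarrow> arr \<sigma> i \<le> \<tau> \<longrightarrow> \<tau> < s i \<longrightarrow> arr \<sigma> j \<le> \<tau> \<longrightarrow> \<tau> < s j \<longrightarrow>
         (\<tau> - arr \<sigma> i) + (\<tau> - arr \<sigma> j) < D i j"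
    by (auto simp: Ball_def)
  then have "greedy_solution d \<sigma> (M, s)"
    unfolding greedy_solution_def mpmd_solution_def D_def prod.case
    by (intro conjI; (assumption | meson not_le))
  then show ?thesis ..
qed

lemma OPT_attained_aux:
  assumes "even (length \<sigma>)"
  obtains S where "mpmd_solution \<sigma> S"
    "\<And>S'. mpmd_solution \<sigma> S' \<Longrightarrow> mpmd_cost d \<sigma> S \<le> mpmd_cost d \<sigma> S'"
proof -
  let ?n = "length \<sigma>"
  define pr where "pr M k = (THE p. p \<in> M \<and> (k = fst p \<or> k = snd p))" for M :: "(nat \<times> nat) set" and k
  define s where "s M k = max (arr \<sigma> (fst (pr M k))) (arr \<sigma> (snd (pr M k)))" for M k
  have ex1: "\<exists>!p. p \<in> M \<and> (k = fst p \<or> k = snd p)"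
    if "perfect_matching_on {..<?n} M" "k < ?n" for M k
    using that unfolding perfect_matching_on_def by (metis lessThan_iff)
  have pr: "pr M k \<in> M \<and> (k = fst (pr M k) \<or> k = snd (pr M k))"
    if "perfect_matching_on {..<?n} M" "k < ?n" for M k
    unfolding pr_def by (rule theI'[OF ex1[OF that]])
  have pr_eq: "pr M k = p"
    if "perfect_matching_on {..<?n} M" "k < ?n" "p \<in> M" "k = fst p \<or> k = snd p" for M k p
    unfolding pr_def by (rule the1_equality[OF ex1[OF that(1,2)] conjI[OF that(3,4)]])
  have bound: "i < ?n \<and> j < ?n" if "perfect_matching_on {..<?n} M" "(i, j) \<in> M" for M i j
    using that by (auto simp: perfect_matching_on_def)
  have sol: "mpmd_solution \<sigma> (M, s M)" if M: "perfect_matching_on {..<?n} M" for M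
  proof -
    have "arr \<sigma> k \<le> s M k" if "k < ?n" for k
      using pr[OF M that] by (auto simp: s_def)
    moreover have "s M i = s M j" if "(i, j) \<in> M" for i j
      using pr_eq[OF M _ that, of i] pr_eq[OF M _ that, of j] bound[OF M that] by (simp add: s_def)
    ultimately show ?thesis using M by (auto simp: mpmd_solution_def)
  qed
  have le: "mpmd_cost d \<sigma> (M, s M) \<le> mpmd_cost d \<sigma> (M, s')" if S: "mpmd_solution \<sigma> (M, s')" for M s'
  proof -
    have M: "perfect_matching_on {..<?n} M" using S by (simp add: mpmd_solution_def)
    have "s M k \<le> s' k" if k: "k < ?n" for k
    proof -
      obtain i j where ij: "pr M k = (i, j)" by (cases "pr M k")
      have p: "(i, j) \<in> M" "k = i \<or> k = j" using pr[OF M k] ij by auto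
      then have "s' i = s' j" "arr \<sigma> i \<le> s' i" "arr \<sigma> j \<le> s' j"
        using S bound[OF M p(1)] by (auto simp: mpmd_solution_def)
      then show ?thesis using p(2) by (auto simp: s_def ij)
    qed
    then show ?thesis by (auto simp: mpmd_cost_def intro!: sum_mono)
  qed
  let ?A = "{M. perfect_matching_on {..<?n} M}"
  have "?A \<subseteq> Pow ({..<?n} \<times> {..<?n})" by (auto simp: perfect_matching_on_def)
  then have fin: "finite ?A" by (rule finite_subset) simp
  obtain S0 where "greedy_solution (\<lambda>_ _. 0) \<sigma> S0"
    using greedy_solution_exists[of "\<lambda>_ _. 0" \<sigma>] assms by auto
  then have ne: "?A \<noteq> {}" by (auto simp: greedy_solution_def mpmd_solution_def)
  define M where "M = arg_min_on (\<lambda>M. mpmd_cost d \<sigma> (M, s M)) ?A"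
  have "M \<in> ?A" unfolding M_def by (rule arg_min_if_finite(1)[OF fin ne])
  moreover have "mpmd_cost d \<sigma> (M, s M) \<le> mpmd_cost d \<sigma> (M', s')" if "mpmd_solution \<sigma> (M', s')" for M' s'
  proof -
    have "M' \<in> ?A" using that by (simp add: mpmd_solution_def)
    then have "mpmd_cost d \<sigma> (M, s M) \<le> mpmd_cost d \<sigma> (M', s M')"
      unfolding M_def using fin ne by (intro arg_min_least[of ?A M' "\<lambda>M. mpmd_cost d \<sigma> (M, s M)"]) auto
    then show ?thesis using le[OF that] by linarith
  qed
  ultimately show thesis using sol[of M] that[of "(M, s M)"] by force
qed

lemma OPT_le:
  assumes "even (length \<sigma>)" "mpmd_solution \<sigma> S"
  shows "OPT d \<sigma> \<le> mpmd_cost d \<sigma> S"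
proof -
  obtain S0 where "\<And>S'. mpmd_solution \<sigma> S' \<Longrightarrow> mpmd_cost d \<sigma> S0 \<le> mpmd_cost d \<sigma> S'"
    using OPT_attained_aux[OF assms(1)] by metis
  then show ?thesis
    unfolding OPT_def using assms(2) by (intro cINF_lower bdd_belowI2) auto
qed

lemma OPT_attained:
  assumes "even (length \<sigma>)"
  shows "\<exists>S. mpmd_solution \<sigma> S \<and> OPT d \<sigma> = mpmd_cost d \<sigma> S"
proof -
  obtain S where S: "mpmd_solution \<sigma> S"
    "\<And>S'. mpmd_solution \<sigma> S' \<Longrightarrow> mpmd_cost d \<sigma> S \<le> mpmd_cost d \<sigma> S'"
    using OPT_attained_aux[OF assms] by metis
  then have "mpmd_cost d \<sigma> S \<le> OPT d \<sigma>"
    unfolding OPT_def by (intro cINF_greatest) blast+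
  then show ?thesis using OPT_le[OF assms S(1)] S(1) by (intro exI[of _ S]) (auto intro: antisym)
qed

end

theory Submission
  imports Defs
begin

text \<open>The critical radius of \<open>x\<close> is the radius \<open>\<rho>\<close> at which the expected number of arrivals in
  the ball around \<open>x\<close> during a time interval of length \<open>\<rho>\<close> crosses 1. Once a request at \<open>x\<close> has
  waited for more than \<open>\<rho>\<close>, Greedy matches it no later than at the next arrival within distance
  \<open>\<rho>\<close>: if that arrival were matched to a third request, the triangle inequality would have allowed
  matching the third request with \<open>x\<close> before. Hence the expected waiting time is at most \<open>2 * \<rho>\<close>, up
  to at most \<open>card X\<close> requests that are pending after the last arrival, and the connection cost is
  at most the waiting cost. Conversely, a request at \<open>x\<close> costs every solution at least half the
  minimal space-time distance to another request, which exceeds \<open>u < \<rho>\<close> with probability at least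
  \<open>exp (- 2 * u / \<rho>)\<close>. The arrivals after a request enter both estimates through one martingale, the
  conditional probability that a set of locations is avoided during a time window.\<close>

section \<open>Limits and integrals of extended nonnegative reals\<close>

lemma limsup_ratio_le:
  fixes a b :: "nat \<Rightarrow> ennreal" and A B C :: real
  assumes upper: "\<And>k. a k \<le> ennreal (A * real k) + ennreal C"
    and lower: "\<And>k. ennreal (B * real k) \<le> b k"
    and "0 \<le> A" "0 < B" "0 \<le> C"
  shows "limsup (\<lambda>k. a k / b k) \<le> ennreal (A / B)"
proof -
  have "a k / b k \<le> ennreal (A / B + C / B * (1 / real k))" if "0 < k" for k
  proof -
    have pos: "0 < B * real k"
      using \<open>0 < B\<close> that by simp
    have "a k \<le> ennreal (A * real k + C)"
      using upper assms by simp
    also have "A * real k + C = B * real k * (A / B + C / B * (1 / real k))"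
      using \<open>0 < B\<close> that by (simp add: field_simps)
    also have "ennreal \<dots> = ennreal (B * real k) * ennreal (A / B + C / B * (1 / real k))"
      using pos by (intro ennreal_mult') simp
    also have "\<dots> \<le> b k * ennreal (A / B + C / B * (1 / real k))"
      by (intro mult_right_mono lower) simp
    finally show ?thesis
      using pos lower[of k]
      by (intro divide_le_posI_ennreal) (auto simp: less_le_trans[of 0 "ennreal _"])
  qed
  then have "limsup (\<lambda>k. a k / b k) \<le> limsup (\<lambda>k. ennreal (A / B + C / B * (1 / real k)))"
    by (intro Limsup_mono eventually_mono[OF eventually_gt_at_top[of 0]])
  also have "(\<lambda>k. A / B + C / B * (1 / real k)) \<longlonglongrightarrow> A / B + C / B * 0"
    by (intro tendsto_intros lim_1_over_n)
  then have "limsup (\<lambda>k. ennreal (A / B + C / B * (1 / real k))) = ennreal (A / B)"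
    by (intro lim_imp_Limsup tendsto_ennrealI) simp_all
  finally show ?thesis .
qed

lemma (in pair_sigma_finite) nn_integral_mult_set_nn_integral:
  assumes [measurable]: "g \<in> borel_measurable M1"
    "case_prod f \<in> borel_measurable (M1 \<Otimes>\<^sub>M M2)" "A \<in> sets M2"
  shows "(\<integral>\<^sup>+x. g x * (\<integral>\<^sup>+y\<in>A. f x y \<partial>M2) \<partial>M1) = (\<integral>\<^sup>+y\<in>A. (\<integral>\<^sup>+x. g x * f x y \<partial>M1) \<partial>M2)"
proof -
  have "(\<integral>\<^sup>+x. g x * (\<integral>\<^sup>+y\<in>A. f x y \<partial>M2) \<partial>M1) = (\<integral>\<^sup>+x. \<integral>\<^sup>+y. g x * f x y * indicator A y \<partial>M2 \<partial>M1)"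
    unfolding mult.assoc by (intro nn_integral_cong nn_integral_cmult[symmetric]) measurable
  also have "\<dots> = (\<integral>\<^sup>+y. \<integral>\<^sup>+x. g x * f x y * indicator A y \<partial>M1 \<partial>M2)"
    by (rule Fubini'[symmetric]) measurable
  also have "\<dots> = (\<integral>\<^sup>+y\<in>A. (\<integral>\<^sup>+x. g x * f x y \<partial>M1) \<partial>M2)"
    by (intro nn_integral_cong nn_integral_multc) measurable
  finally show ?thesis .
qed

section \<open>Perfect matchings\<close>

lemma perfect_matching_on_edgeD:
  assumes "perfect_matching_on U M" "(i, j) \<in> M"
  shows "i \<in> U" "j \<in> U" "i < j"
  using assms by (auto simp: perfect_matching_on_def)

lemma perfect_matching_on_partnerE:
  assumes M: "perfect_matching_on U M" and "k \<in> U"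
  obtains j where "j \<in> U" "j \<noteq> k" "(k, j) \<in> M \<or> (j, k) \<in> M"
proof -
  obtain i j where "(i, j) \<in> M" "k = i \<or> k = j"
    using assms unfolding perfect_matching_on_def by (metis prod.collapse)
  with perfect_matching_on_edgeD[OF M, of i j] show thesis
    using that by blast
qed

lemma sum_perfect_matching_on:
  fixes f :: "nat \<Rightarrow> 'b::comm_monoid_add"
  assumes M: "perfect_matching_on U M" and "finite U"
  shows "(\<Sum>k\<in>U. f k) = (\<Sum>(i, j)\<in>M. f i + f j)"
proof -
  have "M \<subseteq> U \<times> U"
    using M by (auto simp: perfect_matching_on_def)
  then have "finite M"
    using \<open>finite U\<close> by (meson finite_SigmaI finite_subset)
  have "(\<Sum>k\<in>U. f k) = (\<Sum>k\<in>U. \<Sum>p | p \<in> M \<and> k \<in> {fst p, snd p}. f k)"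
  proof (rule sum.cong[OF refl])
    fix k assume "k \<in> U"
    then have "\<exists>!p. p \<in> M \<and> k \<in> {fst p, snd p}"
      using M by (simp add: perfect_matching_on_def)
    then obtain p where "{p. p \<in> M \<and> k \<in> {fst p, snd p}} = {p}"
      by blast
    then show "f k = (\<Sum>p | p \<in> M \<and> k \<in> {fst p, snd p}. f k)"
      by simp
  qed
  also have "\<dots> = (\<Sum>p\<in>M. \<Sum>k | k \<in> U \<and> k \<in> {fst p, snd p}. f k)"
    by (rule sum.swap_restrict[OF \<open>finite U\<close> \<open>finite M\<close>])
  also have "\<dots> = (\<Sum>(i, j)\<in>M. f i + f j)"
  proof (intro sum.cong refl, clarify)
    fix i j assume ij: "(i, j) \<in> M"
    then have "{k. k \<in> U \<and> k \<in> {fst (i, j), snd (i, j)}} = {i, j}" "i \<noteq> j"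
      using perfect_matching_on_edgeD[OF M ij] by auto
    then show "(\<Sum>k | k \<in> U \<and> k \<in> {fst (i, j), snd (i, j)}. f k) = f i + f j"
      by simp
  qed
  finally show ?thesis .
qed

section \<open>Lower bound on the optimal cost\<close>

lemma mpmd_solution_edge:
  assumes S: "mpmd_solution \<sigma> (M, s)" and ij: "(i, j) \<in> M"
  shows "i < length \<sigma>" "j < length \<sigma>" "i \<noteq> j"
    and "\<bar>arr \<sigma> i - arr \<sigma> j\<bar> \<le> (s i - arr \<sigma> i) + (s j - arr \<sigma> j)"
proof -
  have "perfect_matching_on {..<length \<sigma>} M"
    using S by (simp add: mpmd_solution_def)
  from perfect_matching_on_edgeD[OF this ij]
  show *: "i < length \<sigma>" "j < length \<sigma>" "i \<noteq> j"
    by auto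
  then have "arr \<sigma> i \<le> s i" "arr \<sigma> j \<le> s j" "s i = s j"
    using S ij by (auto simp: mpmd_solution_def)
  then show "\<bar>arr \<sigma> i - arr \<sigma> j\<bar> \<le> (s i - arr \<sigma> i) + (s j - arr \<sigma> j)"
    by linarith
qed

lemma sum_le_twice_OPT:
  assumes even: "even (length \<sigma>)" and sym: "\<And>x y. d x y = d y x"
    and nearest: "\<And>i j. i < length \<sigma> \<Longrightarrow> j < length \<sigma> \<Longrightarrow> i \<noteq> j \<Longrightarrow>
              g i \<le> d (loc \<sigma> i) (loc \<sigma> j) + \<bar>arr \<sigma> i - arr \<sigma> j\<bar>"
  shows "(\<Sum>i<length \<sigma>. g i) \<le> 2 * OPT d \<sigma>"
proof -
  obtain M s where S: "mpmd_solution \<sigma> (M, s)" and opt: "OPT d \<sigma> = mpmd_cost d \<sigma> (M, s)"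
    using OPT_attained[OF even, of d] by auto
  have M: "perfect_matching_on {..<length \<sigma>} M"
    using S by (simp add: mpmd_solution_def)
  let ?dist = "\<lambda>i j. d (loc \<sigma> i) (loc \<sigma> j)" and ?wait = "\<lambda>i. s i - arr \<sigma> i"
  have "(\<Sum>i<length \<sigma>. g i) = (\<Sum>(i, j)\<in>M. g i + g j)"
    by (rule sum_perfect_matching_on[OF M]) simp
  also have "\<dots> \<le> (\<Sum>(i, j)\<in>M. 2 * (?dist i j + (?wait i + ?wait j)))"
  proof (intro sum_mono, clarify)
    fix i j assume "(i, j) \<in> M"
    note edge = mpmd_solution_edge[OF S this]
    show "g i + g j \<le> 2 * (?dist i j + (?wait i + ?wait j))"
      using nearest[OF edge(1,2,3)] nearest[OF edge(2,1) edge(3)[symmetric]] edge(4)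
        sym[of "loc \<sigma> j"] by simp
  qed
  also have "\<dots> = 2 * ((\<Sum>(i, j)\<in>M. ?dist i j) + (\<Sum>(i, j)\<in>M. ?wait i + ?wait j))"
    by (simp add: sum_distrib_left split_def flip: sum.distrib)
  also have "(\<Sum>(i, j)\<in>M. ?wait i + ?wait j) = (\<Sum>i<length \<sigma>. ?wait i)"
    by (rule sum_perfect_matching_on[OF M, symmetric]) simp
  finally show ?thesis
    by (simp add: opt mpmd_cost_def)
qed

section \<open>Greedy on a fixed request sequence\<close>

locale greedy_matching = Metric_space X d for X :: "'a set" and d +
  fixes \<sigma> :: "'a requests" and M :: "(nat \<times> nat) set" and s :: "nat \<Rightarrow> real"
  assumes input: "mpmd_input X \<sigma>" and greedy: "greedy_solution d \<sigma> (M, s)"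
begin

abbreviation wait :: "nat \<Rightarrow> real" where
  "wait i \<equiv> s i - arr \<sigma> i"

lemma loc_in_space: "i < length \<sigma> \<Longrightarrow> loc \<sigma> i \<in> X"
  using input by (simp add: mpmd_input_def)

lemma perfect_matching: "perfect_matching_on {..<length \<sigma>} M"
  using greedy by (simp add: greedy_solution_def mpmd_solution_def)

lemma arr_le_match_time: "i < length \<sigma> \<Longrightarrow> arr \<sigma> i \<le> s i"
  using greedy by (simp add: greedy_solution_def mpmd_solution_def)

lemma matched_dist_le_wait: "(i, j) \<in> M \<Longrightarrow> d (loc \<sigma> i) (loc \<sigma> j) \<le> wait i + wait j"
  using greedy by (auto simp: greedy_solution_def)

lemma pending_dist_gt:
  assumes "i < length \<sigma>" "j < length \<sigma>" "i \<noteq> j"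
    and "arr \<sigma> i \<le> \<tau>" "\<tau> < s i" "arr \<sigma> j \<le> \<tau>" "\<tau> < s j"
  shows "(\<tau> - arr \<sigma> i) + (\<tau> - arr \<sigma> j) < d (loc \<sigma> i) (loc \<sigma> j)"
  using greedy assms unfolding greedy_solution_def prod.case by (meson not_le)

lemma partnerE:
  assumes "i < length \<sigma>"
  obtains j where "j < length \<sigma>" "j \<noteq> i" "s j = s i" "d (loc \<sigma> i) (loc \<sigma> j) \<le> wait i + wait j"
proof -
  obtain j where j: "j < length \<sigma>" "j \<noteq> i" "(i, j) \<in> M \<or> (j, i) \<in> M"
    using perfect_matching_on_partnerE[OF perfect_matching, of i] assms by auto
  have eq: "s a = s b" if "(a, b) \<in> M" for a b
    using greedy that by (auto simp: greedy_solution_def mpmd_solution_def)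
  from j(3) have "s j = s i"
    using eq by auto
  moreover from j(3) have "d (loc \<sigma> i) (loc \<sigma> j) \<le> wait i + wait j"
    using matched_dist_le_wait[of i j] matched_dist_le_wait[of j i] commute[of "loc \<sigma> i"] by auto
  ultimately show thesis
    using that j by blast
qed

lemma matched_by_next_near_arrival:
  assumes i: "i < length \<sigma>" and k: "k < length \<sigma>"
    and near: "d (loc \<sigma> i) (loc \<sigma> k) \<le> r" and late: "arr \<sigma> i + r < arr \<sigma> k"
  shows "s i \<le> arr \<sigma> k"
proof (rule ccontr)
  assume "\<not> s i \<le> arr \<sigma> k"
  then have i_pending: "arr \<sigma> k < s i"
    by simp
  have "0 \<le> r"
    using near nonneg order_trans by blast
  have k_matched: "s k = arr \<sigma> k"
  proof (rule ccontr)
    assume "s k \<noteq> arr \<sigma> k"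
    then have "arr \<sigma> k < s k"
      using arr_le_match_time[OF k] by simp
    with pending_dist_gt[of i k "arr \<sigma> k"] i k i_pending near late \<open>0 \<le> r\<close> show False
      by force
  qed
  obtain j where j: "j < length \<sigma>" "j \<noteq> k" "s j = arr \<sigma> k"
    and dist_kj: "d (loc \<sigma> k) (loc \<sigma> j) \<le> arr \<sigma> k - arr \<sigma> j"
    using partnerE[OF k] k_matched by (metis diff_self add_0)
  have "arr \<sigma> j \<noteq> arr \<sigma> k"
    using input j k by (auto simp: mpmd_input_def dest: inj_onD)
  then have "arr \<sigma> j < arr \<sigma> k"
    using arr_le_match_time j by fastforce
  \<comment> \<open>\<open>k\<close> is matched to \<open>j\<close> on arrival, so by the triangle inequality \<open>i\<close> and \<open>j\<close> should have been
    matched at time \<open>\<tau>\<close>\<close>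
  define \<tau> where "\<tau> = max (arr \<sigma> j) ((arr \<sigma> k + arr \<sigma> i + r) / 2)"
  have \<tau>: "arr \<sigma> i \<le> \<tau>" "arr \<sigma> j \<le> \<tau>" "\<tau> < arr \<sigma> k" "arr \<sigma> k + arr \<sigma> i + r \<le> 2 * \<tau>"
    using \<open>arr \<sigma> j < arr \<sigma> k\<close> late \<open>0 \<le> r\<close> unfolding \<tau>_def by (auto simp: max_def)
  have "i \<noteq> j"
    using i_pending j by auto
  then have "(\<tau> - arr \<sigma> i) + (\<tau> - arr \<sigma> j) < d (loc \<sigma> i) (loc \<sigma> j)"
    using pending_dist_gt i j \<tau> i_pending by simp
  also have "\<dots> \<le> d (loc \<sigma> i) (loc \<sigma> k) + d (loc \<sigma> k) (loc \<sigma> j)"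
    using triangle loc_in_space i j k by blast
  finally show False
    using dist_kj near \<tau> by linarith
qed

lemma match_time_le_diameter:
  assumes i: "i < length \<sigma>"
    and last: "\<And>j. j < length \<sigma> \<Longrightarrow> arr \<sigma> j \<le> T"
    and diameter: "\<And>x y. x \<in> X \<Longrightarrow> y \<in> X \<Longrightarrow> d x y \<le> D"
  shows "s i \<le> T + D"
proof (rule ccontr)
  assume late: "\<not> s i \<le> T + D"
  obtain j where j: "j < length \<sigma>" "j \<noteq> i" "s j = s i"
    using partnerE[OF i] by metis
  have dist: "d (loc \<sigma> i) (loc \<sigma> j) \<le> D"
    using diameter loc_in_space i j by blast
  then have "0 \<le> D"
    using nonneg order_trans by blast
  then have "(T + D - arr \<sigma> i) + (T + D - arr \<sigma> j) < d (loc \<sigma> i) (loc \<sigma> j)"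
    using pending_dist_gt[of i j "T + D"] i j late last[OF i] last[OF j(1)] by simp
  then show False
    using last[OF i] last[OF j(1)] \<open>0 \<le> D\<close> dist by linarith
qed

lemma card_pending_le:
  assumes "finite X" and last: "\<And>j. j < length \<sigma> \<Longrightarrow> arr \<sigma> j \<le> T"
  shows "card {i. i < length \<sigma> \<and> T < s i} \<le> card X"
proof (rule card_inj_on_le)
  show "inj_on (loc \<sigma>) {i. i < length \<sigma> \<and> T < s i}"
  proof (rule inj_onI, rule ccontr)
    fix i j
    assume "i \<in> {i. i < length \<sigma> \<and> T < s i}" "j \<in> {i. i < length \<sigma> \<and> T < s i}"
      and same: "loc \<sigma> i = loc \<sigma> j" and "i \<noteq> j"
    then have ij: "i < length \<sigma>" "j < length \<sigma>" "T < s i" "T < s j"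
      by auto
    then have "(T - arr \<sigma> i) + (T - arr \<sigma> j) < d (loc \<sigma> i) (loc \<sigma> j)"
      using \<open>i \<noteq> j\<close> last by (intro pending_dist_gt)
    then show False
      using last[OF ij(1)] last[OF ij(2)] same loc_in_space[OF ij(2)] by simp
  qed
qed (use loc_in_space \<open>finite X\<close> in auto)

lemma sum_wait_after_last_arrival_le:
  assumes "finite X" "X \<noteq> {}"
    and last: "\<And>j. j < length \<sigma> \<Longrightarrow> arr \<sigma> j \<le> T"
    and diameter: "\<And>x y. x \<in> X \<Longrightarrow> y \<in> X \<Longrightarrow> d x y \<le> D"
  shows "(\<Sum>i<length \<sigma>. max 0 (s i - T)) \<le> real (card X) * D"
proof -
  define pending where "pending = {i. i < length \<sigma> \<and> T < s i}"
  have "0 \<le> D"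
    using diameter \<open>X \<noteq> {}\<close> nonneg order_trans by blast
  have "(\<Sum>i<length \<sigma>. max 0 (s i - T)) = (\<Sum>i\<in>pending. max 0 (s i - T))"
    by (intro sum.mono_neutral_right) (auto simp: pending_def)
  also have "\<dots> \<le> (\<Sum>i\<in>pending. D)"
    using match_time_le_diameter[OF _ last diameter] \<open>0 \<le> D\<close>
    by (intro sum_mono) (fastforce simp: pending_def)
  also have "\<dots> \<le> real (card X) * D"
    using card_pending_le[OF \<open>finite X\<close> last] \<open>0 \<le> D\<close>
    by (simp add: pending_def mult_right_mono)
  finally show ?thesis .
qed

lemma cost_le_twice_wait: "mpmd_cost d \<sigma> (M, s) \<le> 2 * (\<Sum>i<length \<sigma>. wait i)"
proof -
  have "(\<Sum>(i, j)\<in>M. d (loc \<sigma> i) (loc \<sigma> j)) \<le> (\<Sum>(i, j)\<in>M. wait i + wait j)"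
    by (intro sum_mono) (auto dest: matched_dist_le_wait)
  also have "\<dots> = (\<Sum>i<length \<sigma>. wait i)"
    by (rule sum_perfect_matching_on[OF perfect_matching, symmetric]) simp
  finally show ?thesis
    by (simp add: mpmd_cost_def)
qed

lemma cost_le_split_wait:
  assumes "finite X" "X \<noteq> {}"
    and last: "\<And>j. j < length \<sigma> \<Longrightarrow> arr \<sigma> j \<le> T"
    and diameter: "\<And>x y. x \<in> X \<Longrightarrow> y \<in> X \<Longrightarrow> d x y \<le> D"
  shows "mpmd_cost d \<sigma> (M, s) \<le>
    2 * (\<Sum>i<length \<sigma>. r i + max 0 (min (s i) T - (arr \<sigma> i + r i))) + 2 * (real (card X) * D)"
proof -
  have "(\<Sum>i<length \<sigma>. wait i) \<le>
      (\<Sum>i<length \<sigma>. r i + max 0 (min (s i) T - (arr \<sigma> i + r i))) + (\<Sum>i<length \<sigma>. max 0 (s i - T))"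
    unfolding sum.distrib[symmetric] by (intro sum_mono) auto
  then show ?thesis
    using cost_le_twice_wait sum_wait_after_last_arrival_le[OF \<open>finite X\<close> \<open>X \<noteq> {}\<close> last diameter]
    by fastforce
qed

end

section \<open>The exponential distribution\<close>

abbreviation exp_law :: "real \<Rightarrow> real measure" where
  "exp_law l \<equiv> density lborel (\<lambda>w. ennreal (exponential_density l w))"

lemma AE_exp_law_pos: "AE w in exp_law l. 0 < w"
proof -
  have "AE w in lborel. 0 < ennreal (exponential_density l w) \<longrightarrow> 0 < w"
    using AE_lborel_singleton[of 0] by eventually_elim (auto simp: exponential_density_def)
  then show ?thesis
    by (simp add: AE_density)
qed

lemma distributed_exp_law: "distributed (exp_law l) lborel (\<lambda>w. w) (exponential_density l)"
proof -
  have "distr (exp_law l) lborel (\<lambda>w. w) = exp_law l"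
    by (rule distr_id2) simp
  then show ?thesis
    by (simp add: distributed_def)
qed

lemma
  assumes l: "0 < l" and a: "0 \<le> a"
  shows emeasure_exp_law_atMost: "emeasure (exp_law l) {..a} = ennreal (1 - exp (- (l * a)))"
    and emeasure_exp_law_greaterThan: "emeasure (exp_law l) {a<..} = ennreal (exp (- (l * a)))"
proof -
  interpret prob_space "exp_law l"
    by (rule prob_space_exponential_density[OF l])
  show "emeasure (exp_law l) {..a} = ennreal (1 - exp (- (l * a)))"
    using exponential_distributedD_le[OF distributed_exp_law a l]
    by (simp add: emeasure_eq_measure atMost_def mult.commute)
  show "emeasure (exp_law l) {a<..} = ennreal (exp (- (l * a)))"
    using exponential_distributedD_gt[OF distributed_exp_law a l]
    by (simp add: emeasure_eq_measure greaterThan_def mult.commute)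
qed

lemma set_nn_integral_exp_atLeast:
  fixes \<kappa> :: real
  assumes "0 < \<kappa>"
  shows "(\<integral>\<^sup>+v\<in>{0..}. ennreal (exp (- (\<kappa> * v))) \<partial>lborel) = ennreal (1 / \<kappa>)"
proof -
  have "(\<integral>\<^sup>+v\<in>{0..}. ennreal (exp (- (\<kappa> * v))) \<partial>lborel) =
      (\<integral>\<^sup>+v. ennreal (1 / \<kappa>) * ennreal (exponential_density \<kappa> v) \<partial>lborel)"
    using assms by (intro nn_integral_cong)
      (auto simp: exponential_density_def indicator_def mult.commute simp flip: ennreal_mult)
  also have "\<dots> = ennreal (1 / \<kappa>) * emeasure (exp_law \<kappa>) (space (exp_law \<kappa>))"
    by (simp add: nn_integral_cmult emeasure_density)
  also have "\<dots> = ennreal (1 / \<kappa>)"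
    using prob_space.emeasure_space_1[OF prob_space_exponential_density[OF assms]] by simp
  finally show ?thesis .
qed

lemma set_nn_integral_exp_Icc:
  fixes \<kappa> :: real
  assumes "0 < \<kappa>" "0 \<le> r"
  shows "(\<integral>\<^sup>+v\<in>{0..r}. ennreal (exp (- (\<kappa> * v))) \<partial>lborel) =
    ennreal ((1 - exp (- (\<kappa> * r))) / \<kappa>)"
proof -
  let ?F = "\<lambda>v. - exp (- (\<kappa> * v)) / \<kappa>"
  have "(\<integral>\<^sup>+v\<in>{0..r}. ennreal (exp (- (\<kappa> * v))) \<partial>lborel) = ennreal (?F r - ?F 0)"
    using assms by (intro nn_integral_FTC_Icc)
      (auto intro!: derivative_eq_intros simp flip: has_real_derivative_iff_has_vector_derivative)
  then show ?thesis
    by (simp add: diff_divide_distrib)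
qed

lemma set_nn_integral_exp_law_thinned:
  assumes l: "0 < l" and q: "0 \<le> q" "q \<le> 1" and ac: "0 \<le> a" "a \<le> c"
  shows "(\<integral>\<^sup>+w\<in>{a<..c}. ennreal ((1 - q) * exp (- (q * l * (c - w)))) \<partial>exp_law l) =
    ennreal (exp (- (q * l * (c - a)) - l * a) - exp (- (l * c)))"
proof -
  let ?f = "\<lambda>w. (1 - q) * exp (- (q * l * (c - w)))"
  let ?F = "\<lambda>w. - exp (- (q * l * (c - w)) - l * w)"
  have "(\<integral>\<^sup>+w\<in>{a<..c}. ennreal (?f w) \<partial>exp_law l) =
      (\<integral>\<^sup>+w. ennreal (exponential_density l w) * (ennreal (?f w) * indicator {a<..c} w) \<partial>lborel)"
    by (subst nn_integral_density) auto
  also have "\<dots> = (\<integral>\<^sup>+w\<in>{a..c}. ennreal (?f w * (l * exp (- (l * w)))) \<partial>lborel)"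
    using AE_lborel_singleton[of a]
  proof (intro nn_integral_cong_AE, eventually_elim)
    fix w :: real assume "w \<noteq> a"
    then show "ennreal (exponential_density l w) * (ennreal (?f w) * indicator {a<..c} w) =
        ennreal (?f w * (l * exp (- (l * w)))) * indicator {a..c} w"
      using ac l q
      by (auto simp: exponential_density_def indicator_def mult_ac simp flip: ennreal_mult)
  qed
  also have "\<dots> = ennreal (?F c - ?F a)"
    using ac l q by (intro nn_integral_FTC_Icc)
      (auto intro!: derivative_eq_intros simp: mult_exp_exp algebra_simps
        simp flip: has_real_derivative_iff_has_vector_derivative)
  finally show ?thesis
    by simp
qed

text \<open>The probability, at time \<open>t\<close>, that a Poisson process of rate \<open>\<kappa>\<close> has no further points in
  \<open>{b<..c}\<close>.\<close>

definition void_prob :: "real \<Rightarrow> real \<Rightarrow> real \<Rightarrow> real \<Rightarrow> ennreal" where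
  "void_prob \<kappa> b c t = ennreal (exp (- (\<kappa> * max 0 (c - max b t))))"

definition unselected_prob :: "real \<Rightarrow> real set \<Rightarrow> real \<Rightarrow> ennreal" where
  "unselected_prob q I t = (if t \<in> I then ennreal (1 - q) else 1)"

text \<open>Thinning: the points of a Poisson process of rate \<open>l\<close> that are selected independently with
  probability \<open>q\<close> form a Poisson process of rate \<open>q * l\<close>.\<close>

lemma nn_integral_void_prob_start:
  assumes l: "0 < l" and q: "0 \<le> q" "q \<le> 1" and ac: "0 \<le> a" "a \<le> c"
  shows "(\<integral>\<^sup>+w. unselected_prob q {a<..c} w * void_prob (q * l) a c w \<partial>exp_law l) =
    void_prob (q * l) a c 0"
proof -
  let ?e = "\<lambda>v. exp (- (q * l * v))"
  have "(\<integral>\<^sup>+w. unselected_prob q {a<..c} w * void_prob (q * l) a c w \<partial>exp_law l) =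
      (\<integral>\<^sup>+w. ennreal (?e (c - a)) * indicator {..a} w +
        (ennreal ((1 - q) * ?e (c - w)) * indicator {a<..c} w + indicator {c<..} w) \<partial>exp_law l)"
    using ac q by (intro nn_integral_cong)
      (auto simp: unselected_prob_def void_prob_def indicator_def ennreal_mult)
  also have "\<dots> = ennreal (?e (c - a)) * ennreal (1 - exp (- (l * a))) +
      (ennreal (?e (c - a) * exp (- (l * a)) - exp (- (l * c))) + ennreal (exp (- (l * c))))"
    using ac l set_nn_integral_exp_law_thinned[OF l q ac]
    by (simp add: nn_integral_add nn_integral_cmult emeasure_exp_law_atMost
        emeasure_exp_law_greaterThan mult_exp_exp)
  also have "\<dots> = ennreal (?e (c - a))"
  proof -
    have "q * l * (c - a) \<le> 1 * l * (c - a)"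
      using ac l q by (intro mult_right_mono) auto
    then have "exp (- (l * c)) \<le> ?e (c - a) * exp (- (l * a))"
      by (simp add: mult_exp_exp algebra_simps)
    then show ?thesis
      using ac l by (simp add: algebra_simps flip: ennreal_mult ennreal_plus)
  qed
  finally show ?thesis
    using ac by (simp add: void_prob_def)
qed

lemma nn_integral_void_prob:
  assumes l: "0 < l" and q: "0 \<le> q" "q \<le> 1" and "b \<le> c"
  shows "(\<integral>\<^sup>+w. unselected_prob q {b<..c} (t + w) * void_prob (q * l) b c (t + w) \<partial>exp_law l) =
    void_prob (q * l) b c t"
proof -
  define a' c' where "a' = max 0 (b - t)" and "c' = max 0 (c - t)"
  have "(\<integral>\<^sup>+w. unselected_prob q {b<..c} (t + w) * void_prob (q * l) b c (t + w) \<partial>exp_law l) =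
      (\<integral>\<^sup>+w. unselected_prob q {a'<..c'} w * void_prob (q * l) a' c' w \<partial>exp_law l)"
    using AE_exp_law_pos
  proof (intro nn_integral_cong_AE, eventually_elim)
    fix w :: real assume "0 < w"
    then have "t + w \<in> {b<..c} \<longleftrightarrow> w \<in> {a'<..c'}"
      and "max 0 (c - max b (t + w)) = max 0 (c' - max a' w)"
      by (auto simp: a'_def c'_def max_def)
    then show "unselected_prob q {b<..c} (t + w) * void_prob (q * l) b c (t + w) =
        unselected_prob q {a'<..c'} w * void_prob (q * l) a' c' w"
      by (simp only: unselected_prob_def void_prob_def)
  qed
  also have "\<dots> = void_prob (q * l) a' c' 0"
    using \<open>b \<le> c\<close> by (intro nn_integral_void_prob_start l q) (auto simp: a'_def c'_def)
  also have "max 0 (c' - max a' 0) = max 0 (c - max b t)"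
    using \<open>b \<le> c\<close> by (auto simp: a'_def c'_def max_def)
  then have "void_prob (q * l) a' c' 0 = void_prob (q * l) b c t"
    by (simp only: void_prob_def)
  finally show ?thesis .
qed

lemma exp_law_renewal_lower_bound:
  assumes l: "0 < l" and q: "0 \<le> q" "q \<le> 1" and "0 \<le> u"
    and h: "\<And>v. 0 \<le> v \<Longrightarrow> ennreal ((1 - q) * exp (- (q * l * v))) \<le> h v"
    and h_neg: "\<And>v. v < 0 \<Longrightarrow> 1 \<le> h v"
  shows "ennreal (exp (- (q * l * u))) \<le> (\<integral>\<^sup>+w. h (u - w) \<partial>exp_law l)"
proof -
  have "ennreal (exp (- (q * l * u))) = void_prob (q * l) 0 u 0"
    using \<open>0 \<le> u\<close> by (simp add: void_prob_def)
  also have "\<dots> = (\<integral>\<^sup>+w. unselected_prob q {0<..u} w * void_prob (q * l) 0 u w \<partial>exp_law l)"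
    using l q \<open>0 \<le> u\<close> by (intro nn_integral_void_prob_start[symmetric]) auto
  also have "\<dots> \<le> (\<integral>\<^sup>+w. h (u - w) \<partial>exp_law l)"
    using AE_exp_law_pos
  proof (intro nn_integral_mono_AE, eventually_elim)
    fix w :: real assume "0 < w"
    then show "unselected_prob q {0<..u} w * void_prob (q * l) 0 u w \<le> h (u - w)"
      using h[of "u - w"] h_neg[of "u - w"] q
      by (auto simp: unselected_prob_def void_prob_def ennreal_mult)
  qed
  finally show ?thesis .
qed

section \<open>The Poisson arrival process\<close>

text \<open>The request with index \<open>k\<close> arrives at time \<open>clock \<omega> (Suc k)\<close>.\<close>

definition clock :: "(nat \<Rightarrow> real \<times> 'a) \<Rightarrow> nat \<Rightarrow> real" where
  "clock \<omega> n = (\<Sum>j<n. fst (\<omega> j))"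

lemma clock_Suc: "clock \<omega> (Suc n) = clock \<omega> n + fst (\<omega> n)"
  by (simp add: clock_def)

lemma clock_upd [simp]: "n \<le> k \<Longrightarrow> clock (\<omega> (k := z)) n = clock \<omega> n"
  by (auto simp: clock_def intro: sum.cong)

lemma clock_upd_Suc [simp]: "clock (\<omega> (n := z)) (Suc n) = clock \<omega> n + fst z"
  by (simp add: clock_Suc)

lemma clock_less:
  assumes "\<And>k. k < n \<Longrightarrow> 0 < fst (\<omega> k)" "i < j" "j \<le> n"
  shows "clock \<omega> i < clock \<omega> j"
  unfolding clock_def using assms by (intro sum_strict_mono2[where b = i]) (auto intro: less_imp_le)

lemma clock_mono:
  assumes "\<And>k. k < n \<Longrightarrow> 0 < fst (\<omega> k)" "i \<le> j" "j \<le> n"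
  shows "clock \<omega> i \<le> clock \<omega> j"
  using clock_less[of n \<omega> i j] assms by (cases "i = j") auto

lemma request_seq_simps:
  "length (request_seq n \<omega>) = n"
  "i < n \<Longrightarrow> loc (request_seq n \<omega>) i = snd (\<omega> i)"
  "i < n \<Longrightarrow> arr (request_seq n \<omega>) i = clock \<omega> (Suc i)"
  by (auto simp: request_seq_def clock_def lessThan_Suc_atMost)

definition no_visits :: "nat set \<Rightarrow> 'a set \<Rightarrow> real set \<Rightarrow> (nat \<Rightarrow> real \<times> 'a) \<Rightarrow> bool" where
  "no_visits K B I \<omega> \<longleftrightarrow> (\<forall>k\<in>K. snd (\<omega> k) \<in> B \<longrightarrow> clock \<omega> (Suc k) \<notin> I)"

lemma no_visits_upd [simp]:
  assumes "K \<subseteq> {..<n}"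
  shows "no_visits K B I (\<omega> (n := z)) \<longleftrightarrow> no_visits K B I \<omega>"
proof -
  have "k < n" if "k \<in> K" for k
    using assms that by auto
  then show ?thesis
    unfolding no_visits_def by (intro ball_cong refl) (auto simp: Suc_le_eq)
qed

lemma no_visits_insert_upd:
  assumes "K \<subseteq> {..<n}"
  shows "no_visits (insert n K) B I (\<omega> (n := z)) \<longleftrightarrow>
    \<not> (snd z \<in> B \<and> clock \<omega> n + fst z \<in> I) \<and> no_visits K B I \<omega>"
proof -
  have "no_visits (insert n K) B I (\<omega> (n := z)) \<longleftrightarrow>
      \<not> (snd z \<in> B \<and> clock \<omega> n + fst z \<in> I) \<and> no_visits K B I (\<omega> (n := z))"
    by (simp add: no_visits_def)
  then show ?thesis
    using assms by simp
qed

locale poisson_arrival_process =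
  fixes X :: "'a set" and rate :: "'a \<Rightarrow> real"
  assumes finite_X: "finite X" and X_nonempty: "X \<noteq> {}"
    and rate_pos: "\<And>x. x \<in> X \<Longrightarrow> 0 < rate x"
begin

abbreviation waiting_law :: "real measure" where
  "waiting_law \<equiv> exp_law (sum rate X)"

abbreviation location_law :: "'a measure" where
  "location_law \<equiv> point_measure X (\<lambda>x. ennreal (rate x / sum rate X))"

abbreviation request_law :: "(real \<times> 'a) measure" where
  "request_law \<equiv> waiting_law \<Otimes>\<^sub>M location_law"

abbreviation arrivals :: "nat \<Rightarrow> (nat \<Rightarrow> real \<times> 'a) measure" where
  "arrivals \<equiv> poisson_arrivals X rate"

lemma arrivals_eq_PiM: "arrivals n = (\<Pi>\<^sub>M i\<in>{..<n}. request_law)"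
  by (simp add: poisson_arrivals_def)

lemma total_rate_pos: "0 < sum rate X"
  using finite_X X_nonempty rate_pos by (simp add: sum_pos)

lemma prob_space_waiting_law: "prob_space waiting_law"
  by (rule prob_space_exponential_density[OF total_rate_pos])

lemma prob_space_location_law: "prob_space location_law"
proof -
  have "(\<Sum>x\<in>X. rate x / sum rate X) = 1"
    using total_rate_pos by (simp flip: sum_divide_distrib)
  then show ?thesis
    using finite_X rate_pos total_rate_pos
    by (intro prob_space_point_measure) (auto simp: less_imp_le)
qed

sublocale location: prob_space location_law
  by (rule prob_space_location_law)

sublocale request: prob_space request_law
  by (rule prob_space_pair[OF prob_space_waiting_law prob_space_location_law])

sublocale arrivals: product_sigma_finite "\<lambda>_ :: nat. request_law"
  by standard

sublocale arrivals: prob_space "arrivals n" for n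
  by (rule prob_space_poisson_arrivals[OF finite_X X_nonempty rate_pos])

lemma space_arrivals: "\<omega> \<in> space (arrivals n) \<Longrightarrow> k < n \<Longrightarrow> snd (\<omega> k) \<in> X"
  by (auto simp: arrivals_eq_PiM space_PiM space_pair_measure space_point_measure PiE_def Pi_def
      mem_Times_iff)

lemma sets_location_law: "B \<subseteq> X \<Longrightarrow> B \<in> sets location_law"
  by (simp add: sets_point_measure)

lemma prob_location:
  assumes "B \<subseteq> X"
  shows "location.prob B = sum rate B / sum rate X"
proof -
  have "emeasure location_law B = ennreal (\<Sum>x\<in>B. rate x / sum rate X)"
    using assms finite_X rate_pos total_rate_pos
    by (subst emeasure_point_measure_finite) (auto intro!: sum_ennreal simp: subset_iff less_imp_le)
  moreover have "0 \<le> (\<Sum>x\<in>B. rate x / sum rate X)"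
    using assms rate_pos total_rate_pos by (auto intro!: sum_nonneg simp: subset_iff less_imp_le)
  ultimately show ?thesis
    by (simp add: measure_def sum_divide_distrib)
qed

lemma sum_rate_eq: "B \<subseteq> X \<Longrightarrow> sum rate B = location.prob B * sum rate X"
  using total_rate_pos by (simp add: prob_location)

lemma
  assumes "B \<subseteq> X"
  shows nn_integral_location_in:
      "(\<integral>\<^sup>+y. of_bool (y \<in> B) \<partial>location_law) = ennreal (location.prob B)"
    and nn_integral_location_not_in:
      "(\<integral>\<^sup>+y. of_bool (y \<notin> B) \<partial>location_law) = ennreal (1 - location.prob B)"
proof -
  note B = sets_location_law[OF assms]
  have "(\<integral>\<^sup>+y. of_bool (y \<in> B) \<partial>location_law) = (\<integral>\<^sup>+y. indicator B y \<partial>location_law)"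
    by (simp add: indicator_def)
  also have "\<dots> = ennreal (location.prob B)"
    using B by (simp add: location.emeasure_eq_measure)
  finally show "(\<integral>\<^sup>+y. of_bool (y \<in> B) \<partial>location_law) = ennreal (location.prob B)" .
  have "(\<integral>\<^sup>+y. of_bool (y \<notin> B) \<partial>location_law) =
      (\<integral>\<^sup>+y. indicator (space location_law - B) y \<partial>location_law)"
    by (intro nn_integral_cong) (simp add: indicator_def)
  also have "\<dots> = ennreal (location.prob (space location_law - B))"
    using B by (simp add: location.emeasure_eq_measure)
  finally show "(\<integral>\<^sup>+y. of_bool (y \<notin> B) \<partial>location_law) = ennreal (1 - location.prob B)"
    by (simp add: location.prob_compl[OF B])
qed

lemma nn_integral_request:
  "f \<in> borel_measurable request_law \<Longrightarrow>
    (\<integral>\<^sup>+z. f z \<partial>request_law) = (\<integral>\<^sup>+w. \<integral>\<^sup>+y. f (w, y) \<partial>location_law \<partial>waiting_law)"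
  by (rule location.nn_integral_fst[symmetric])

lemma nn_integral_request_mult:
  assumes [measurable]: "f \<in> borel_measurable borel" "g \<in> borel_measurable location_law"
  shows "(\<integral>\<^sup>+z. f (fst z) * g (snd z) \<partial>request_law) =
    (\<integral>\<^sup>+w. f w \<partial>waiting_law) * (\<integral>\<^sup>+y. g y \<partial>location_law)"
  by (subst nn_integral_request) (simp_all add: nn_integral_cmult nn_integral_multc)

lemma
  assumes "f \<in> borel_measurable (arrivals (Suc n))"
  shows nn_integral_arrivals_Suc: "(\<integral>\<^sup>+\<omega>. f \<omega> \<partial>arrivals (Suc n)) =
      (\<integral>\<^sup>+\<omega>. \<integral>\<^sup>+z. f (\<omega> (n := z)) \<partial>request_law \<partial>arrivals n)"
    and nn_integral_arrivals_Suc_rev: "(\<integral>\<^sup>+\<omega>. f \<omega> \<partial>arrivals (Suc n)) =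
      (\<integral>\<^sup>+z. \<integral>\<^sup>+\<omega>. f (\<omega> (n := z)) \<partial>arrivals n \<partial>request_law)"
  using assms unfolding arrivals_eq_PiM lessThan_Suc
  by (auto intro: arrivals.product_nn_integral_insert arrivals.product_nn_integral_insert_rev)

lemma measurable_next_request:
  assumes "\<omega> \<in> space (arrivals n)" and [measurable]: "f \<in> borel_measurable (arrivals (Suc n))"
  shows "(\<lambda>z. f (\<omega> (n := z))) \<in> borel_measurable request_law"
proof -
  have "(\<lambda>z. \<omega> (n := z)) \<in> request_law \<rightarrow>\<^sub>M arrivals (Suc n)"
    using assms(1) unfolding arrivals_eq_PiM lessThan_Suc
    by (intro measurable_component_update) auto
  then show ?thesis
    by (rule measurable_compose) measurable
qed

lemma nn_integral_component:
  assumes "k < n" and f: "f \<in> borel_measurable request_law"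
  shows "(\<integral>\<^sup>+\<omega>. f (\<omega> k) \<partial>arrivals n) = (\<integral>\<^sup>+z. f z \<partial>request_law)"
proof -
  have "distr (arrivals n) request_law (\<lambda>\<omega>. \<omega> k) = request_law"
    unfolding arrivals_eq_PiM
    using \<open>k < n\<close> by (intro distr_PiM_component request.prob_space_axioms) simp
  then have "(\<integral>\<^sup>+z. f z \<partial>request_law) = (\<integral>\<^sup>+z. f z \<partial>distr (arrivals n) request_law (\<lambda>\<omega>. \<omega> k))"
    by simp
  also have "\<dots> = (\<integral>\<^sup>+\<omega>. f (\<omega> k) \<partial>arrivals n)"
    using \<open>k < n\<close> f unfolding arrivals_eq_PiM
    by (intro nn_integral_distr measurable_component_singleton) auto
  finally show ?thesis ..
qed

lemma AE_waiting_times_pos: "AE \<omega> in arrivals n. \<forall>k<n. 0 < fst (\<omega> k)"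
proof -
  have "AE w in distr request_law waiting_law fst. 0 < w"
    unfolding location.distr_pair_fst by (rule AE_exp_law_pos)
  then have "AE z in request_law. 0 < fst z"
    by (rule AE_distrD[rotated]) (rule measurable_fst)
  then have "\<forall>k\<in>{..<n}. AE \<omega> in arrivals n. 0 < fst (\<omega> k)"
    unfolding arrivals_eq_PiM
    by (intro ballI AE_PiM_component[where P = "\<lambda>z. 0 < fst z"] request.prob_space_axioms)
  then have "AE \<omega> in arrivals n. \<forall>k\<in>{..<n}. 0 < fst (\<omega> k)"
    by (subst AE_finite_all) auto
  then show ?thesis
    by (simp add: Ball_def)
qed

lemma measurable_request_component:
  assumes f: "f \<in> N \<rightarrow>\<^sub>M arrivals n" and g: "g \<in> request_law \<rightarrow>\<^sub>M L" "g undefined \<in> space L"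
  shows "(\<lambda>x. g (f x k)) \<in> N \<rightarrow>\<^sub>M L"
proof (cases "k < n")
  case True
  from f[unfolded arrivals_eq_PiM] show ?thesis
    by (rule measurable_compose[OF measurable_compose])
      (use True in \<open>auto intro: measurable_component_singleton g(1)\<close>)
next
  case False
  then have "f x k = undefined" if "x \<in> space N" for x
    using measurable_space[OF f that]
    by (auto simp: arrivals_eq_PiM space_PiM PiE_def extensional_def)
  then show ?thesis
    using g(2) by (subst measurable_cong[of _ _ "\<lambda>_. g undefined"]) auto
qed

lemma measurable_waiting_time:
  assumes "f \<in> N \<rightarrow>\<^sub>M arrivals n"
  shows "(\<lambda>x. fst (f x k)) \<in> borel_measurable N"
  using assms by (rule measurable_request_component) simp_all

lemma measurable_location:
  assumes "f \<in> N \<rightarrow>\<^sub>M arrivals n"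
  shows "(\<lambda>x. snd (f x k)) \<in> N \<rightarrow>\<^sub>M count_space UNIV"
proof (rule measurable_request_component[OF assms])
  have "(\<lambda>y. y) \<in> location_law \<rightarrow>\<^sub>M count_space UNIV"
    by (auto simp: measurable_def space_point_measure sets_point_measure)
  then show "snd \<in> request_law \<rightarrow>\<^sub>M count_space UNIV"
    by (rule measurable_compose[OF measurable_snd])
qed simp

lemma measurable_location_mem:
  assumes "f \<in> N \<rightarrow>\<^sub>M arrivals n"
  shows "Measurable.pred N (\<lambda>x. snd (f x k) \<in> B)"
  using measurable_location[OF assms] by (rule measurable_compose) simp

lemma measurable_location_eq [measurable (raw)]:
  assumes "f \<in> N \<rightarrow>\<^sub>M arrivals n"
  shows "Measurable.pred N (\<lambda>x. snd (f x k) = y)"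
  using measurable_location_mem[OF assms, of k "{y}"] by simp

lemma measurable_clock [measurable (raw)]:
  assumes f: "f \<in> N \<rightarrow>\<^sub>M arrivals n"
  shows "(\<lambda>x. clock (f x) k) \<in> borel_measurable N"
  unfolding clock_def by (intro borel_measurable_sum measurable_waiting_time[OF f])

lemma
  assumes f [measurable]: "f \<in> N \<rightarrow>\<^sub>M arrivals n"
    and [measurable]: "b \<in> borel_measurable N" "c \<in> borel_measurable N"
  shows measurable_no_visits_greaterThanAtMost [measurable (raw)]:
      "Measurable.pred N (\<lambda>x. no_visits K B {b x<..c x} (f x))"
    and measurable_no_visits_atLeast [measurable (raw)]:
      "Measurable.pred N (\<lambda>x. no_visits K B {b x..} (f x))"
proof -
  note [measurable] = measurable_location_mem[OF f]
  show "Measurable.pred N (\<lambda>x. no_visits K B {b x<..c x} (f x))"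
    unfolding no_visits_def greaterThanAtMost_iff by measurable
  show "Measurable.pred N (\<lambda>x. no_visits K B {b x..} (f x))"
    unfolding no_visits_def atLeast_iff by measurable
qed

lemma measurable_at_location:
  assumes "\<And>x. x \<in> X \<Longrightarrow> F x \<in> borel_measurable (arrivals n)" "i < n"
  shows "(\<lambda>\<omega>. F (snd (\<omega> i)) \<omega>) \<in> borel_measurable (arrivals n)"
proof (rule measurable_compose_countable'[of X])
  have "(\<lambda>\<omega>. snd (\<omega> i)) \<in> arrivals n \<rightarrow>\<^sub>M restrict_space (count_space UNIV) X"
    using measurable_location[of "\<lambda>\<omega>. \<omega>" "arrivals n" n i] space_arrivals \<open>i < n\<close>
    by (intro measurable_restrict_space2) auto
  then show "(\<lambda>\<omega>. snd (\<omega> i)) \<in> arrivals n \<rightarrow>\<^sub>M count_space X"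
    by (simp add: restrict_count_space)
qed (use assms finite_X in \<open>auto intro: countable_finite\<close>)

lemma nn_integral_by_location:
  assumes F: "\<And>x. x \<in> X \<Longrightarrow> F x \<in> borel_measurable (arrivals n)" and "i < n"
  shows "(\<integral>\<^sup>+\<omega>. F (snd (\<omega> i)) \<omega> \<partial>arrivals n) =
    (\<Sum>x\<in>X. \<integral>\<^sup>+\<omega>. of_bool (snd (\<omega> i) = x) * F x \<omega> \<partial>arrivals n)"
proof -
  have "(\<integral>\<^sup>+\<omega>. F (snd (\<omega> i)) \<omega> \<partial>arrivals n) =
      (\<integral>\<^sup>+\<omega>. (\<Sum>x\<in>X. of_bool (snd (\<omega> i) = x) * F x \<omega>) \<partial>arrivals n)"
  proof (intro nn_integral_cong)
    fix \<omega> assume "\<omega> \<in> space (arrivals n)"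
    then have "snd (\<omega> i) \<in> X"
      using \<open>i < n\<close> by (rule space_arrivals)
    then show "F (snd (\<omega> i)) \<omega> = (\<Sum>x\<in>X. of_bool (snd (\<omega> i) = x) * F x \<omega>)"
      using finite_X by (simp add: of_bool_def if_distrib[of "\<lambda>c. c * _"] cong: if_cong)
  qed
  also have "\<dots> = (\<Sum>x\<in>X. \<integral>\<^sup>+\<omega>. of_bool (snd (\<omega> i) = x) * F x \<omega> \<partial>arrivals n)"
    using F by (intro nn_integral_sum borel_measurable_times_ennreal) measurable
  finally show ?thesis .
qed

lemma nn_integral_location_eq:
  assumes "x \<in> X" "i < n"
  shows "(\<integral>\<^sup>+\<omega>. of_bool (snd (\<omega> i) = x) \<partial>arrivals n) = ennreal (location.prob {x})"
proof -
  have [measurable]: "{x} \<in> sets location_law"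
    using \<open>x \<in> X\<close> by (intro sets_location_law) simp
  have "(\<integral>\<^sup>+\<omega>. of_bool (snd (\<omega> i) \<in> {x}) \<partial>arrivals n) = (\<integral>\<^sup>+z. of_bool (snd z \<in> {x}) \<partial>request_law)"
    by (rule nn_integral_component[OF \<open>i < n\<close>]) measurable
  also have "\<dots> = ennreal (location.prob {x})"
    using nn_integral_request_mult[of "\<lambda>_. 1" "\<lambda>y. of_bool (y \<in> {x})"]
      nn_integral_location_in[of "{x}"] \<open>x \<in> X\<close>
      prob_space.emeasure_space_1[OF prob_space_waiting_law] by simp
  finally show ?thesis
    by simp
qed

section \<open>Avoiding a set of locations\<close>

text \<open>A martingale in \<open>n\<close>: the conditional probability, given the first \<open>n\<close> requests of an infinite
  sequence, that no request after \<open>i\<close> arrives in \<open>B\<close> during the window of length \<open>v\<close> that opens \<open>a\<close>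
  time units after request \<open>i\<close>.\<close>

definition avoidance :: "'a set \<Rightarrow> nat \<Rightarrow> real \<Rightarrow> real \<Rightarrow> nat \<Rightarrow> (nat \<Rightarrow> real \<times> 'a) \<Rightarrow> ennreal" where
  "avoidance B i a v n \<omega> =
     of_bool (no_visits {i<..<n} B {clock \<omega> (Suc i) + a<..clock \<omega> (Suc i) + a + v} \<omega>) *
     void_prob (sum rate B) (clock \<omega> (Suc i) + a) (clock \<omega> (Suc i) + a + v) (clock \<omega> n)"

lemma measurable_avoidance [measurable]: "avoidance B i a v n \<in> borel_measurable (arrivals m)"
  unfolding avoidance_def void_prob_def by measurable

lemma nn_integral_avoidance_Suc:
  assumes B: "B \<subseteq> X" and "0 \<le> v" "i < n"
  shows "(\<integral>\<^sup>+z. avoidance B i a v (Suc n) (\<omega> (n := z)) \<partial>request_law) = avoidance B i a v n \<omega>"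
proof -
  define b c t where "b = clock \<omega> (Suc i) + a" and "c = b + v" and "t = clock \<omega> n"
  define q where "q = location.prob B"
  define free :: ennreal where "free = of_bool (no_visits {i<..<n} B {b<..c} \<omega>)"
  note rate = sum_rate_eq[OF B, folded q_def]
  let ?void = "void_prob (q * sum rate X) b c"
  note [measurable] = sets_location_law[OF B]
  have "{i<..<Suc n} = insert n {i<..<n}" "{i<..<n} \<subseteq> {..<n}"
    using \<open>i < n\<close> by auto
  then have upd: "avoidance B i a v (Suc n) (\<omega> (n := z)) =
      free * (of_bool (snd z \<in> B \<longrightarrow> t + fst z \<notin> {b<..c}) * ?void (t + fst z))" for z
    using \<open>i < n\<close>
    by (simp add: avoidance_def no_visits_insert_upd free_def b_def c_def t_def rate Suc_le_eq
        del: greaterThanAtMost_iff)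
  have new: "(\<integral>\<^sup>+y. of_bool (y \<in> B \<longrightarrow> t + w \<notin> {b<..c}) \<partial>location_law) =
      unselected_prob q {b<..c} (t + w)" for w
    using nn_integral_location_not_in[OF B] location.emeasure_space_1
    by (simp add: q_def unselected_prob_def)
  let ?miss = "\<lambda>w y. of_bool (y \<in> B \<longrightarrow> t + w \<notin> {b<..c}) :: ennreal"
  have "(\<integral>\<^sup>+z. avoidance B i a v (Suc n) (\<omega> (n := z)) \<partial>request_law) =
      free * (\<integral>\<^sup>+z. ?miss (fst z) (snd z) * ?void (t + fst z) \<partial>request_law)"
    unfolding upd void_prob_def by (rule nn_integral_cmult) measurable
  also have "(\<integral>\<^sup>+z. ?miss (fst z) (snd z) * ?void (t + fst z) \<partial>request_law) =
      (\<integral>\<^sup>+w. \<integral>\<^sup>+y. ?miss w y * ?void (t + w) \<partial>location_law \<partial>waiting_law)"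
    by (subst nn_integral_request) (simp_all add: void_prob_def)
  also have "\<dots> = (\<integral>\<^sup>+w. unselected_prob q {b<..c} (t + w) * ?void (t + w) \<partial>waiting_law)"
    unfolding new[symmetric] by (intro nn_integral_cong nn_integral_multc) measurable
  also have "\<dots> = ?void t"
    using \<open>0 \<le> v\<close> total_rate_pos by (intro nn_integral_void_prob) (simp_all add: q_def c_def)
  also have "free * ?void t = avoidance B i a v n \<omega>"
    by (simp add: avoidance_def free_def b_def c_def t_def rate)
  finally show ?thesis .
qed

lemma nn_integral_avoidance:
  assumes B: "B \<subseteq> X" and "0 \<le> a" "0 \<le> v" "i < n"
    and measurable_past: "\<And>m. g \<in> borel_measurable (arrivals m)"
    and past: "\<And>\<omega> k z. i < k \<Longrightarrow> g (\<omega> (k := z)) = g \<omega>"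
  shows "(\<integral>\<^sup>+\<omega>. g \<omega> * avoidance B i a v n \<omega> \<partial>arrivals n) =
    (\<integral>\<^sup>+\<omega>. g \<omega> \<partial>arrivals (Suc i)) * ennreal (exp (- (sum rate B * v)))"
  using Suc_leI[OF \<open>i < n\<close>]
proof (induction n rule: dec_induct)
  case base
  have "{i<..<Suc i} = {}"
    by auto
  then have "avoidance B i a v (Suc i) \<omega> = ennreal (exp (- (sum rate B * v)))" for \<omega>
    using \<open>0 \<le> a\<close> \<open>0 \<le> v\<close> by (simp add: avoidance_def void_prob_def no_visits_def)
  then show ?case
    using measurable_past by (simp add: nn_integral_multc)
next
  case (step n)
  note [measurable] = measurable_past
  have "(\<integral>\<^sup>+\<omega>. g \<omega> * avoidance B i a v (Suc n) \<omega> \<partial>arrivals (Suc n)) =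
      (\<integral>\<^sup>+\<omega>. \<integral>\<^sup>+z. g \<omega> * avoidance B i a v (Suc n) (\<omega> (n := z)) \<partial>request_law \<partial>arrivals n)"
    using step.hyps by (subst nn_integral_arrivals_Suc) (simp_all add: past Suc_le_eq)
  also have "\<dots> = (\<integral>\<^sup>+\<omega>. g \<omega> * avoidance B i a v n \<omega> \<partial>arrivals n)"
  proof (intro nn_integral_cong)
    fix \<omega> assume "\<omega> \<in> space (arrivals n)"
    then have "(\<lambda>z. avoidance B i a v (Suc n) (\<omega> (n := z))) \<in> borel_measurable request_law"
      by (rule measurable_next_request) measurable
    then show "(\<integral>\<^sup>+z. g \<omega> * avoidance B i a v (Suc n) (\<omega> (n := z)) \<partial>request_law) =
        g \<omega> * avoidance B i a v n \<omega>"
      using step.hyps \<open>0 \<le> v\<close> by (simp add: nn_integral_cmult nn_integral_avoidance_Suc[OF B])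
  qed
  finally show ?case
    using step.IH by simp
qed

definition unvisited :: "'a set \<Rightarrow> nat \<Rightarrow> real \<Rightarrow> nat \<Rightarrow> real \<Rightarrow> (nat \<Rightarrow> real \<times> 'a) \<Rightarrow> bool" where
  "unvisited B i a n v \<omega> \<longleftrightarrow>
     no_visits {i<..<n} B {clock \<omega> (Suc i) + a<..clock \<omega> (Suc i) + a + v} \<omega> \<and>
     clock \<omega> (Suc i) + a + v < clock \<omega> n"

lemma measurable_unvisited [measurable (raw)]:
  assumes [measurable]: "f \<in> N \<rightarrow>\<^sub>M arrivals m" "v \<in> borel_measurable N"
  shows "Measurable.pred N (\<lambda>x. unvisited B i a n (v x) (f x))"
  unfolding unvisited_def by measurable

lemma nn_integral_unvisited_le:
  assumes B: "B \<subseteq> X" and x: "x \<in> X" and "0 \<le> a" "0 \<le> v" "i < n"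
  shows "(\<integral>\<^sup>+\<omega>. of_bool (snd (\<omega> i) = x) * of_bool (unvisited B i a n v \<omega>) \<partial>arrivals n) \<le>
    ennreal (location.prob {x}) * ennreal (exp (- (sum rate B * v)))"
proof -
  have "of_bool (unvisited B i a n v \<omega>) \<le> avoidance B i a v n \<omega>" for \<omega>
    by (auto simp: unvisited_def avoidance_def void_prob_def max_def)
  then have "(\<integral>\<^sup>+\<omega>. of_bool (snd (\<omega> i) = x) * of_bool (unvisited B i a n v \<omega>) \<partial>arrivals n) \<le>
      (\<integral>\<^sup>+\<omega>. of_bool (snd (\<omega> i) = x) * avoidance B i a v n \<omega> \<partial>arrivals n)"
    by (intro nn_integral_mono mult_left_mono) auto
  also have "\<dots> =
      (\<integral>\<^sup>+\<omega>. of_bool (snd (\<omega> i) = x) \<partial>arrivals (Suc i)) * ennreal (exp (- (sum rate B * v)))"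
    using assms by (intro nn_integral_avoidance) auto
  finally show ?thesis
    by (simp add: nn_integral_location_eq[OF x])
qed

text \<open>The layer-cake form of the time that passes, from \<open>a\<close> time units after request \<open>i\<close>, until the
  next request in \<open>B\<close> or else until the last of the \<open>n\<close> requests.\<close>

definition overrun :: "'a set \<Rightarrow> nat \<Rightarrow> real \<Rightarrow> nat \<Rightarrow> (nat \<Rightarrow> real \<times> 'a) \<Rightarrow> ennreal" where
  "overrun B i a n \<omega> = (\<integral>\<^sup>+v\<in>{0..}. of_bool (unvisited B i a n v \<omega>) \<partial>lborel)"

lemma measurable_overrun [measurable]: "overrun B i a n \<in> borel_measurable (arrivals m)"
  unfolding overrun_def by measurable

lemma overrun_ge:
  assumes next_visit: "\<And>k. i < k \<Longrightarrow> k < n \<Longrightarrow> snd (\<omega> k) \<in> B \<Longrightarrow>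
      clock \<omega> (Suc i) + a < clock \<omega> (Suc k) \<Longrightarrow> s \<le> clock \<omega> (Suc k)"
  shows "ennreal (min s (clock \<omega> n) - (clock \<omega> (Suc i) + a)) \<le> overrun B i a n \<omega>"
proof -
  define b where "b = clock \<omega> (Suc i) + a"
  have "ennreal (min s (clock \<omega> n) - b) = (\<integral>\<^sup>+v. indicator {0..<min s (clock \<omega> n) - b} v \<partial>lborel)"
    by (cases "0 \<le> min s (clock \<omega> n) - b") (auto simp: ennreal_neg)
  also have "\<dots> \<le> overrun B i a n \<omega>"
    unfolding overrun_def unvisited_def b_def[symmetric]
  proof (intro nn_integral_mono)
    fix v
    have "b + v < s" "b + v < clock \<omega> n" if "v < min s (clock \<omega> n) - b"
      using that by linarith+
    moreover have "no_visits {i<..<n} B {b<..b + v} \<omega>" if "b + v < s"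
      using next_visit that by (fastforce simp: no_visits_def b_def)
    ultimately show "(indicator {0..<min s (clock \<omega> n) - b} v :: ennreal) \<le>
        of_bool (no_visits {i<..<n} B {b<..b + v} \<omega> \<and> b + v < clock \<omega> n) * indicator {0..} v"
      by (auto simp: indicator_def)
  qed
  finally show ?thesis
    by (simp add: b_def)
qed

lemma nn_integral_overrun_le:
  assumes B: "B \<subseteq> X" and rate: "0 < sum rate B" and "0 \<le> a" and x: "x \<in> X" and "i < n"
  shows "(\<integral>\<^sup>+\<omega>. of_bool (snd (\<omega> i) = x) * overrun B i a n \<omega> \<partial>arrivals n) \<le>
    ennreal (location.prob {x} / sum rate B)"
proof -
  interpret pair_sigma_finite "arrivals n" lborel ..
  have "(\<integral>\<^sup>+\<omega>. of_bool (snd (\<omega> i) = x) * overrun B i a n \<omega> \<partial>arrivals n) =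
      (\<integral>\<^sup>+v\<in>{0..}. (\<integral>\<^sup>+\<omega>. of_bool (snd (\<omega> i) = x) * of_bool (unvisited B i a n v \<omega>)
        \<partial>arrivals n) \<partial>lborel)"
    unfolding overrun_def by (rule nn_integral_mult_set_nn_integral) measurable
  also have "\<dots> \<le> (\<integral>\<^sup>+v\<in>{0..}.
      ennreal (location.prob {x}) * ennreal (exp (- (sum rate B * v))) \<partial>lborel)"
    using nn_integral_unvisited_le[OF B x \<open>0 \<le> a\<close> _ \<open>i < n\<close>]
    by (intro nn_integral_mono) (auto simp: indicator_def)
  also have "\<dots> = ennreal (location.prob {x}) *
      (\<integral>\<^sup>+v\<in>{0..}. ennreal (exp (- (sum rate B * v))) \<partial>lborel)"
    unfolding mult.assoc by (rule nn_integral_cmult) measurable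
  also have "\<dots> = ennreal (location.prob {x} / sum rate B)"
    using rate by (simp add: set_nn_integral_exp_atLeast flip: ennreal_mult)
  finally show ?thesis .
qed

text \<open>Unlike the window after \<open>i\<close>, the one before \<open>i\<close> ends at a random time; the requests are
  revealed backwards.\<close>

definition lookback_prob :: "'a set \<Rightarrow> nat \<Rightarrow> real \<Rightarrow> ennreal" where
  "lookback_prob B n v = (\<integral>\<^sup>+\<omega>. of_bool (no_visits {..<n} B {clock \<omega> n - v..} \<omega>) \<partial>arrivals n)"

lemma borel_measurable_lookback_prob [measurable]: "lookback_prob B n \<in> borel_measurable borel"
proof -
  have "(\<lambda>v. \<integral>\<^sup>+\<omega>. of_bool (no_visits {..<n} B {clock \<omega> n - v..} \<omega>) \<partial>arrivals n)
      \<in> borel_measurable borel"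
    by measurable
  then show ?thesis
    by (simp add: lookback_prob_def[abs_def])
qed

lemma lookback_prob_neg:
  assumes "v < 0"
  shows "lookback_prob B n v = 1"
proof -
  have "lookback_prob B n v = (\<integral>\<^sup>+\<omega>. 1 \<partial>arrivals n)"
    unfolding lookback_prob_def using AE_waiting_times_pos
  proof (intro nn_integral_cong_AE, eventually_elim)
    fix \<omega> :: "nat \<Rightarrow> real \<times> 'a" assume "\<forall>k<n. 0 < fst (\<omega> k)"
    then have "clock \<omega> (Suc k) \<le> clock \<omega> n" if "k < n" for k
      using that by (intro clock_mono[of n]) auto
    then show "of_bool (no_visits {..<n} B {clock \<omega> n - v..} \<omega>) = (1 :: ennreal)"
      using \<open>v < 0\<close> by (fastforce simp: no_visits_def)
  qed
  then show ?thesis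
    by (simp add: arrivals.emeasure_space_1)
qed

lemma lookback_prob_Suc:
  assumes B: "B \<subseteq> X" and "0 \<le> v"
  shows "lookback_prob B (Suc n) v =
    ennreal (1 - location.prob B) * (\<integral>\<^sup>+w. lookback_prob B n (v - w) \<partial>waiting_law)"
proof -
  note [measurable] = sets_location_law[OF B]
  have upd: "no_visits {..<Suc n} B {clock (\<omega> (n := z)) (Suc n) - v..} (\<omega> (n := z)) \<longleftrightarrow>
      snd z \<notin> B \<and> no_visits {..<n} B {clock \<omega> n - (v - fst z)..} \<omega>" for \<omega> z
    using \<open>0 \<le> v\<close> by (simp add: lessThan_Suc no_visits_insert_upd algebra_simps)
  have "lookback_prob B (Suc n) v = (\<integral>\<^sup>+z. \<integral>\<^sup>+\<omega>. of_bool
      (no_visits {..<Suc n} B {clock (\<omega> (n := z)) (Suc n) - v..} (\<omega> (n := z)))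
      \<partial>arrivals n \<partial>request_law)"
    unfolding lookback_prob_def by (rule nn_integral_arrivals_Suc_rev) measurable
  also have "\<dots> = (\<integral>\<^sup>+z. \<integral>\<^sup>+\<omega>. of_bool (snd z \<notin> B) *
      of_bool (no_visits {..<n} B {clock \<omega> n - (v - fst z)..} \<omega>) \<partial>arrivals n \<partial>request_law)"
    by (simp only: upd of_bool_conj)
  also have "\<dots> = (\<integral>\<^sup>+z. lookback_prob B n (v - fst z) * of_bool (snd z \<notin> B) \<partial>request_law)"
    by (simp add: nn_integral_cmult lookback_prob_def mult.commute)
  also have "\<dots> =
      (\<integral>\<^sup>+w. lookback_prob B n (v - w) \<partial>waiting_law) * (\<integral>\<^sup>+y. of_bool (y \<notin> B) \<partial>location_law)"
    by (rule nn_integral_request_mult) measurable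
  finally show ?thesis
    by (simp add: nn_integral_location_not_in[OF B] mult.commute)
qed

lemma nn_integral_lookback_prob_ge:
  assumes B: "B \<subseteq> X" and "0 \<le> u"
  shows "ennreal (exp (- (sum rate B * u))) \<le> (\<integral>\<^sup>+w. lookback_prob B n (u - w) \<partial>waiting_law)"
proof -
  define q where "q = location.prob B"
  note rate = sum_rate_eq[OF B, folded q_def]
  have q: "0 \<le> q" "q \<le> 1"
    by (simp_all add: q_def)
  show ?thesis
    using \<open>0 \<le> u\<close> unfolding rate
  proof (induction n arbitrary: u)
    case 0
    show ?case
    proof (rule exp_law_renewal_lower_bound[OF total_rate_pos q \<open>0 \<le> u\<close>])
      fix v :: real assume "0 \<le> v"
      show "ennreal ((1 - q) * exp (- (q * sum rate X * v))) \<le> lookback_prob B 0 v"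
      proof -
        have "(1 - q) * exp (- (q * sum rate X * v)) \<le> 1 * 1"
          using q \<open>0 \<le> v\<close> total_rate_pos by (intro mult_mono) auto
        then show ?thesis
          by (simp add: lookback_prob_def no_visits_def arrivals.emeasure_space_1)
      qed
    qed (simp add: lookback_prob_neg)
  next
    case (Suc n)
    show ?case
    proof (rule exp_law_renewal_lower_bound[OF total_rate_pos q \<open>0 \<le> u\<close>])
      fix v :: real assume "0 \<le> v"
      then show "ennreal ((1 - q) * exp (- (q * sum rate X * v))) \<le> lookback_prob B (Suc n) v"
        using Suc.IH q
        by (simp add: lookback_prob_Suc[OF B] ennreal_mult mult_left_mono flip: q_def)
    qed (simp add: lookback_prob_neg)
  qed
qed

definition isolated :: "'a set \<Rightarrow> nat \<Rightarrow> nat \<Rightarrow> real \<Rightarrow> (nat \<Rightarrow> real \<times> 'a) \<Rightarrow> bool" where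
  "isolated B i n u \<omega> \<longleftrightarrow> no_visits {..<i} B {clock \<omega> (Suc i) - u..} \<omega> \<and>
     no_visits {i<..<n} B {clock \<omega> (Suc i)<..clock \<omega> (Suc i) + u} \<omega>"

lemma measurable_isolated [measurable (raw)]:
  assumes [measurable]: "f \<in> N \<rightarrow>\<^sub>M arrivals n" "u \<in> borel_measurable N"
  shows "Measurable.pred N (\<lambda>x. isolated B i m (u x) (f x))"
  unfolding isolated_def by measurable

lemma isolated_arrival_gap:
  assumes isolated: "isolated B i n u \<omega>" and "i < n" "k < n" "k \<noteq> i" "snd (\<omega> k) \<in> B"
    and pos: "\<And>j. j < n \<Longrightarrow> 0 < fst (\<omega> j)"
  shows "u < \<bar>clock \<omega> (Suc i) - clock \<omega> (Suc k)\<bar>"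
proof (cases "k < i")
  case True
  then have "clock \<omega> (Suc k) < clock \<omega> (Suc i) - u"
    using assms by (simp add: isolated_def no_visits_def not_le)
  then show ?thesis
    by linarith
next
  case False
  then have "clock \<omega> (Suc i) < clock \<omega> (Suc k)"
    using clock_less[OF pos] assms by simp
  moreover have "clock \<omega> (Suc k) \<notin> {clock \<omega> (Suc i)<..clock \<omega> (Suc i) + u}"
    using False assms by (simp add: isolated_def no_visits_def)
  ultimately show ?thesis
    by simp
qed

lemma nn_integral_isolated_before_ge:
  assumes B: "B \<subseteq> X" and x: "x \<in> X" and "0 \<le> u"
  shows "ennreal (location.prob {x} * exp (- (sum rate B * u))) \<le>
    (\<integral>\<^sup>+\<omega>. of_bool (snd (\<omega> i) = x \<and> no_visits {..<i} B {clock \<omega> (Suc i) - u..} \<omega>)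
      \<partial>arrivals (Suc i))"
proof -
  have [measurable]: "{x} \<in> sets location_law"
    using x by (intro sets_location_law) simp
  have "ennreal (location.prob {x} * exp (- (sum rate B * u))) =
      ennreal (exp (- (sum rate B * u))) * ennreal (location.prob {x})"
    by (simp add: ennreal_mult mult.commute)
  also have "\<dots> \<le> (\<integral>\<^sup>+w. lookback_prob B i (u - w) \<partial>waiting_law) * ennreal (location.prob {x})"
    by (intro mult_right_mono nn_integral_lookback_prob_ge[OF B \<open>0 \<le> u\<close>]) simp
  also have "\<dots> = (\<integral>\<^sup>+z. lookback_prob B i (u - fst z) * of_bool (snd z \<in> {x}) \<partial>request_law)"
    using x
    by (subst nn_integral_request_mult) (auto simp: nn_integral_location_in[of "{x}", simplified])
  also have "\<dots> = (\<integral>\<^sup>+z. \<integral>\<^sup>+\<omega>. of_bool (snd z = x \<and>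
      no_visits {..<i} B {clock \<omega> i - (u - fst z)..} \<omega>) \<partial>arrivals i \<partial>request_law)"
    by (simp add: of_bool_conj nn_integral_cmult lookback_prob_def mult.commute)
  also have "\<dots> = (\<integral>\<^sup>+\<omega>. of_bool (snd (\<omega> i) = x \<and>
      no_visits {..<i} B {clock \<omega> (Suc i) - u..} \<omega>) \<partial>arrivals (Suc i))"
    by (subst nn_integral_arrivals_Suc_rev) (simp_all add: algebra_simps)
  finally show ?thesis .
qed

lemma nn_integral_isolated_ge:
  assumes B: "B \<subseteq> X" and x: "x \<in> X" and "0 \<le> u" "i < n"
  shows "ennreal (location.prob {x} * exp (- (2 * sum rate B * u))) \<le>
    (\<integral>\<^sup>+\<omega>. of_bool (snd (\<omega> i) = x) * of_bool (isolated B i n u \<omega>) \<partial>arrivals n)"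
proof -
  let ?past = "\<lambda>\<omega>. of_bool (snd (\<omega> i) = x \<and>
    no_visits {..<i} B {clock \<omega> (Suc i) - u..} \<omega>) :: ennreal"
  have "ennreal (location.prob {x} * exp (- (2 * sum rate B * u))) =
      ennreal (location.prob {x} * exp (- (sum rate B * u))) * ennreal (exp (- (sum rate B * u)))"
    by (simp add: mult_exp_exp mult.assoc flip: ennreal_mult)
  also have "\<dots> \<le> (\<integral>\<^sup>+\<omega>. ?past \<omega> \<partial>arrivals (Suc i)) * ennreal (exp (- (sum rate B * u)))"
    by (intro mult_right_mono nn_integral_isolated_before_ge[OF B x \<open>0 \<le> u\<close>]) simp
  also have "\<dots> = (\<integral>\<^sup>+\<omega>. ?past \<omega> * avoidance B i 0 u n \<omega> \<partial>arrivals n)"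
    using \<open>0 \<le> u\<close> \<open>i < n\<close> by (intro nn_integral_avoidance[OF B, symmetric]) (auto simp: subset_eq)
  also have "\<dots> \<le> (\<integral>\<^sup>+\<omega>. of_bool (snd (\<omega> i) = x) * of_bool (isolated B i n u \<omega>) \<partial>arrivals n)"
  proof (intro nn_integral_mono)
    fix \<omega> :: "nat \<Rightarrow> real \<times> 'a"
    have "0 \<le> sum rate B"
      using B rate_pos by (intro sum_nonneg) (auto simp: less_imp_le)
    then show "?past \<omega> * avoidance B i 0 u n \<omega> \<le>
        of_bool (snd (\<omega> i) = x) * of_bool (isolated B i n u \<omega>)"
      by (auto simp: isolated_def avoidance_def void_prob_def)
  qed
  finally show ?thesis .
qed

text \<open>The layer-cake form of the time between request \<open>i\<close> and the nearest other request in \<open>B\<close>,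
  capped at \<open>r\<close>.\<close>

definition clearance :: "'a set \<Rightarrow> nat \<Rightarrow> real \<Rightarrow> nat \<Rightarrow> (nat \<Rightarrow> real \<times> 'a) \<Rightarrow> ennreal" where
  "clearance B i r n \<omega> = (\<integral>\<^sup>+u\<in>{0..r}. of_bool (isolated B i n u \<omega>) \<partial>lborel)"

lemma measurable_clearance [measurable]: "clearance B i r n \<in> borel_measurable (arrivals m)"
  unfolding clearance_def by measurable

lemma clearance_le:
  assumes "0 \<le> c" and "\<And>u. 0 \<le> u \<Longrightarrow> u \<le> r \<Longrightarrow> isolated B i n u \<omega> \<Longrightarrow> u \<le> c"
  shows "clearance B i r n \<omega> \<le> ennreal c"
proof -
  have "clearance B i r n \<omega> \<le> (\<integral>\<^sup>+u. indicator {0..c} u \<partial>lborel)"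
    unfolding clearance_def using assms(2) by (intro nn_integral_mono) (auto simp: indicator_def)
  then show ?thesis
    using \<open>0 \<le> c\<close> by simp
qed

lemma nn_integral_clearance_ge:
  assumes B: "B \<subseteq> X" and r: "0 < r" "sum rate B * r \<le> 1" and x: "x \<in> X" and "i < n"
  shows "ennreal (location.prob {x} * (r * ((1 - exp (-2)) / 2))) \<le>
    (\<integral>\<^sup>+\<omega>. of_bool (snd (\<omega> i) = x) * clearance B i r n \<omega> \<partial>arrivals n)"
proof -
  interpret pair_sigma_finite "arrivals n" lborel ..
  let ?tail = "\<lambda>u \<omega>. of_bool (snd (\<omega> i) = x) * of_bool (isolated B i n u \<omega>) :: ennreal"
  have tail: "ennreal (location.prob {x}) * ennreal (exp (- (2 / r * u))) \<le>
      (\<integral>\<^sup>+\<omega>. ?tail u \<omega> \<partial>arrivals n)" if "0 \<le> u" for u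
  proof -
    have "2 * sum rate B * u \<le> 2 / r * u"
      using r that by (intro mult_right_mono) (auto simp: field_simps)
    then have "ennreal (location.prob {x} * exp (- (2 / r * u))) \<le>
        ennreal (location.prob {x} * exp (- (2 * sum rate B * u)))"
      by (intro ennreal_leI mult_left_mono) auto
    also have "\<dots> \<le> (\<integral>\<^sup>+\<omega>. ?tail u \<omega> \<partial>arrivals n)"
      by (rule nn_integral_isolated_ge[OF B x that \<open>i < n\<close>])
    finally show ?thesis
      by (simp only: ennreal_mult' measure_nonneg)
  qed
  have "(\<integral>\<^sup>+u\<in>{0..r}. ennreal (exp (- (2 / r * u))) \<partial>lborel) = ennreal (r * ((1 - exp (-2)) / 2))"
    using set_nn_integral_exp_Icc[of "2 / r" r] r by (simp add: field_simps)
  then have "ennreal (location.prob {x} * (r * ((1 - exp (-2)) / 2))) =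
      ennreal (location.prob {x}) * (\<integral>\<^sup>+u\<in>{0..r}. ennreal (exp (- (2 / r * u))) \<partial>lborel)"
    by (simp only: ennreal_mult' measure_nonneg)
  also have "\<dots> = (\<integral>\<^sup>+u\<in>{0..r}.
      ennreal (location.prob {x}) * ennreal (exp (- (2 / r * u))) \<partial>lborel)"
    unfolding mult.assoc by (rule nn_integral_cmult[symmetric]) measurable
  also have "\<dots> \<le> (\<integral>\<^sup>+u\<in>{0..r}. (\<integral>\<^sup>+\<omega>. ?tail u \<omega> \<partial>arrivals n) \<partial>lborel)"
    using tail by (intro nn_integral_mono) (auto simp: indicator_def)
  also have "\<dots> = (\<integral>\<^sup>+\<omega>. of_bool (snd (\<omega> i) = x) * clearance B i r n \<omega> \<partial>arrivals n)"
    unfolding clearance_def by (rule nn_integral_mult_set_nn_integral[symmetric]) measurable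
  finally show ?thesis .
qed

end

section \<open>Critical radii\<close>

locale poisson_mpmd = Metric_space X d + poisson_arrival_process X rate
  for X :: "'a set" and d :: "'a \<Rightarrow> 'a \<Rightarrow> real" and rate :: "'a \<Rightarrow> real"
begin

text \<open>This is the least \<open>r\<close> with \<open>1 \<le> r * sum rate (mcball x r)\<close>: on each interval where the ball is
  constant the condition amounts to the lower bound \<open>1 / sum rate (mcball x r)\<close>.\<close>

definition critical_radius :: "'a \<Rightarrow> real" where
  "critical_radius x = (MIN y\<in>X. max (d x y) (1 / sum rate (mcball x (d x y))))"

lemma rate_mcball_mono: "r \<le> r' \<Longrightarrow> sum rate (mcball x r) \<le> sum rate (mcball x r')"
  using finite_subset[OF mcball_subset_mspace finite_X] rate_pos
  by (intro sum_mono2 mcball_subset_concentric) (auto intro: less_imp_le)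

lemma rate_mcball_pos: "x \<in> X \<Longrightarrow> 0 \<le> r \<Longrightarrow> 0 < sum rate (mcball x r)"
  using finite_subset[OF mcball_subset_mspace finite_X] rate_pos by (intro sum_pos) auto

lemma critical_radius_attained:
  assumes "x \<in> X"
  obtains y where "y \<in> X" "critical_radius x = max (d x y) (1 / sum rate (mcball x (d x y)))"
proof -
  have "critical_radius x \<in> (\<lambda>y. max (d x y) (1 / sum rate (mcball x (d x y)))) ` X"
    unfolding critical_radius_def using finite_X \<open>x \<in> X\<close> by (intro Min_in) auto
  then show thesis
    using that by blast
qed

lemma critical_radius_pos:
  assumes "x \<in> X"
  shows "0 < critical_radius x"
proof -
  obtain y where "critical_radius x = max (d x y) (1 / sum rate (mcball x (d x y)))"
    using critical_radius_attained[OF assms] by metis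
  then show ?thesis
    using rate_mcball_pos[OF assms, of "d x y"] by (simp add: less_max_iff_disj)
qed

lemma rate_mcball_critical_radius_ge:
  assumes "x \<in> X"
  shows "1 \<le> critical_radius x * sum rate (mcball x (critical_radius x))"
proof -
  obtain y where y: "critical_radius x = max (d x y) (1 / sum rate (mcball x (d x y)))"
    using critical_radius_attained[OF assms] by metis
  have pos: "0 < sum rate (mcball x (d x y))"
    by (rule rate_mcball_pos[OF assms]) simp
  then have "1 = 1 / sum rate (mcball x (d x y)) * sum rate (mcball x (d x y))"
    by simp
  also have "\<dots> \<le> critical_radius x * sum rate (mcball x (critical_radius x))"
    using pos y critical_radius_pos[OF assms] rate_mcball_mono[of "d x y" "critical_radius x" x]
    by (intro mult_mono) auto
  finally show ?thesis .
qed

lemma rate_mball_critical_radius_le: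
  assumes "x \<in> X"
  shows "sum rate (mball x (critical_radius x)) * critical_radius x \<le> 1"
proof -
  have "finite (mball x (critical_radius x))" "mball x (critical_radius x) \<noteq> {}"
    using finite_subset[OF mball_subset_mspace finite_X] assms critical_radius_pos[OF assms]
    by (auto simp: mball_eq_empty)
  then obtain y where "y \<in> mball x (critical_radius x)"
    and y_max: "\<And>z. z \<in> mball x (critical_radius x) \<Longrightarrow> d x z \<le> d x y"
    by (metis obtains_MAX Max_ge finite_imageI imageI)
  then have y: "y \<in> X" "d x y < critical_radius x"
    by auto
  have "mball x (critical_radius x) = mcball x (d x y)"
    using y y_max by fastforce
  moreover have "critical_radius x \<le> max (d x y) (1 / sum rate (mcball x (d x y)))"
    unfolding critical_radius_def using finite_X y(1) by (intro Min_le) auto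
  then have "critical_radius x \<le> 1 / sum rate (mcball x (d x y))"
    using y(2) by simp
  ultimately show ?thesis
    using rate_mcball_pos[OF assms, of "d x y"] by (simp add: field_simps)
qed

definition mean_radius :: real where
  "mean_radius = (\<Sum>x\<in>X. location.prob {x} * critical_radius x)"

lemma mean_radius_pos: "0 < mean_radius"
  unfolding mean_radius_def using finite_X X_nonempty rate_pos total_rate_pos critical_radius_pos
  by (intro sum_pos) (auto simp: prob_location)

lemma sum_location_critical_radius:
  assumes "0 \<le> c"
  shows "(\<Sum>x\<in>X. ennreal (location.prob {x} * (critical_radius x * c))) = ennreal (mean_radius * c)"
proof -
  have "(\<Sum>x\<in>X. ennreal (location.prob {x} * (critical_radius x * c))) =
      ennreal (\<Sum>x\<in>X. location.prob {x} * (critical_radius x * c))"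
    using assms critical_radius_pos by (intro sum_ennreal) (simp add: less_imp_le)
  then show ?thesis
    by (simp add: mean_radius_def sum_distrib_right mult.assoc)
qed

lemma measurable_critical_radius:
  "i < n \<Longrightarrow> (\<lambda>\<omega>. ennreal (critical_radius (snd (\<omega> i)))) \<in> borel_measurable (arrivals n)"
  using measurable_at_location[of "\<lambda>x _. ennreal (critical_radius x)"] by simp

lemma nn_integral_critical_radius:
  assumes "i < n"
  shows "(\<integral>\<^sup>+\<omega>. ennreal (critical_radius (snd (\<omega> i))) \<partial>arrivals n) = ennreal mean_radius"
proof -
  have "(\<integral>\<^sup>+\<omega>. ennreal (critical_radius (snd (\<omega> i))) \<partial>arrivals n) =
      (\<Sum>x\<in>X. \<integral>\<^sup>+\<omega>. of_bool (snd (\<omega> i) = x) * ennreal (critical_radius x) \<partial>arrivals n)"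
    using assms by (intro nn_integral_by_location) auto
  also have "\<dots> = (\<Sum>x\<in>X. ennreal (location.prob {x} * (critical_radius x * 1)))"
    using assms critical_radius_pos
    by (intro sum.cong refl)
      (simp add: nn_integral_multc nn_integral_location_eq ennreal_mult less_imp_le)
  finally show ?thesis
    using sum_location_critical_radius[of 1] by simp
qed

section \<open>Expected cost of Greedy\<close>

abbreviation near :: "'a \<Rightarrow> 'a set" where
  "near x \<equiv> mcball x (critical_radius x)"

abbreviation near_overrun :: "nat \<Rightarrow> nat \<Rightarrow> (nat \<Rightarrow> real \<times> 'a) \<Rightarrow> ennreal" where
  "near_overrun i n \<omega> \<equiv> overrun (near (snd (\<omega> i))) i (critical_radius (snd (\<omega> i))) n \<omega>"

lemma measurable_near_overrun: "i < n \<Longrightarrow> near_overrun i n \<in> borel_measurable (arrivals n)"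
  using measurable_at_location[of "\<lambda>x. overrun (near x) i (critical_radius x) n"] by simp

lemma nn_integral_near_overrun_le:
  assumes "i < n"
  shows "(\<integral>\<^sup>+\<omega>. near_overrun i n \<omega> \<partial>arrivals n) \<le> ennreal mean_radius"
proof -
  have "(\<integral>\<^sup>+\<omega>. near_overrun i n \<omega> \<partial>arrivals n) =
      (\<Sum>x\<in>X. \<integral>\<^sup>+\<omega>. of_bool (snd (\<omega> i) = x) * overrun (near x) i (critical_radius x) n \<omega>
        \<partial>arrivals n)"
    using assms by (intro nn_integral_by_location) auto
  also have "\<dots> \<le> (\<Sum>x\<in>X. ennreal (location.prob {x} * (critical_radius x * 1)))"
  proof (intro sum_mono)
    fix x assume x: "x \<in> X"
    have pos: "0 < critical_radius x" "0 < sum rate (near x)"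
      using critical_radius_pos[OF x] rate_mcball_pos[OF x] by auto
    have "(\<integral>\<^sup>+\<omega>. of_bool (snd (\<omega> i) = x) * overrun (near x) i (critical_radius x) n \<omega>
        \<partial>arrivals n) \<le> ennreal (location.prob {x} / sum rate (near x))"
      using pos x assms by (intro nn_integral_overrun_le mcball_subset_mspace) auto
    also have "\<dots> \<le> ennreal (location.prob {x} * (critical_radius x * 1))"
    proof (rule ennreal_leI)
      have "location.prob {x} * (1 / sum rate (near x)) \<le> location.prob {x} * critical_radius x"
        using rate_mcball_critical_radius_ge[OF x] pos
        by (intro mult_left_mono) (auto simp: field_simps)
      then show "location.prob {x} / sum rate (near x) \<le>
          location.prob {x} * (critical_radius x * 1)"
        by simp
    qed
    finally show "(\<integral>\<^sup>+\<omega>. of_bool (snd (\<omega> i) = x) * overrun (near x) i (critical_radius x) n \<omega>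
        \<partial>arrivals n) \<le> ennreal (location.prob {x} * (critical_radius x * 1))" .
  qed
  finally show ?thesis
    using sum_location_critical_radius[of 1] by simp
qed

lemma mpmd_input_request_seq:
  assumes "even n" "\<omega> \<in> space (arrivals n)" and pos: "\<And>k. k < n \<Longrightarrow> 0 < fst (\<omega> k)"
  shows "mpmd_input X (request_seq n \<omega>)"
proof -
  have "strict_mono_on {..<n} (arr (request_seq n \<omega>))"
    using clock_less[OF pos] by (intro strict_mono_onI) (simp add: request_seq_simps)
  then have "inj_on (arr (request_seq n \<omega>)) {..<n}"
    by (rule strict_mono_on_imp_inj_on)
  moreover have "0 \<le> clock \<omega> (Suc i)" if "i < n" for i
    unfolding clock_def using that pos by (intro sum_nonneg) (auto intro: less_imp_le)
  ultimately show ?thesis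
    using assms space_arrivals by (auto simp: mpmd_input_def request_seq_simps)
qed

lemma greedy_late_le_near_overrun:
  assumes "greedy_matching X d (request_seq n \<omega>) M s" and i: "i < n"
  shows "ennreal (min (s i) (clock \<omega> n) - (clock \<omega> (Suc i) + critical_radius (snd (\<omega> i)))) \<le>
    near_overrun i n \<omega>"
proof (rule overrun_ge)
  interpret greedy_matching X d "request_seq n \<omega>" M s
    by fact
  let ?\<rho> = "critical_radius (snd (\<omega> i))"
  fix k assume "k < n" "snd (\<omega> k) \<in> near (snd (\<omega> i))" "clock \<omega> (Suc i) + ?\<rho> < clock \<omega> (Suc k)"
  then show "s i \<le> clock \<omega> (Suc k)"
    using matched_by_next_near_arrival[of i k ?\<rho>] i by (simp add: request_seq_simps)
qed

lemma greedy_cost_le_near_overrun: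
  assumes \<omega>: "\<omega> \<in> space (arrivals n)" and pos: "\<And>k. k < n \<Longrightarrow> 0 < fst (\<omega> k)" and "even n"
    and greedy: "greedy_solution d (request_seq n \<omega>) S"
    and diameter: "\<And>x y. x \<in> X \<Longrightarrow> y \<in> X \<Longrightarrow> d x y \<le> D"
  shows "ennreal (mpmd_cost d (request_seq n \<omega>) S) \<le>
    2 * (\<Sum>i<n. ennreal (critical_radius (snd (\<omega> i))) + near_overrun i n \<omega>) +
    ennreal (2 * (real (card X) * D))"
proof -
  obtain M s where S: "S = (M, s)"
    by (cases S)
  interpret greedy_matching X d "request_seq n \<omega>" M s
    using mpmd_input_request_seq[OF \<open>even n\<close> \<omega> pos] greedy by unfold_locales (auto simp: S)
  let ?\<rho> = "\<lambda>i. critical_radius (snd (\<omega> i))"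
  let ?late = "\<lambda>i. max 0 (min (s i) (clock \<omega> n) - (clock \<omega> (Suc i) + ?\<rho> i))"
  have "0 \<le> D"
    using diameter X_nonempty nonneg order_trans by blast
  have radius_nonneg: "0 \<le> ?\<rho> i" if "i < n" for i
    using critical_radius_pos[OF space_arrivals[OF \<omega> that]] by simp
  have wait: "ennreal (?\<rho> i + ?late i) \<le> ennreal (?\<rho> i) + near_overrun i n \<omega>" if "i < n" for i
    using greedy_late_le_near_overrun[OF greedy_matching_axioms that] radius_nonneg[OF that]
    by (simp add: add_left_mono max_def ennreal_neg)
  have "mpmd_cost d (request_seq n \<omega>) S \<le> 2 * (\<Sum>i<n. ?\<rho> i + ?late i) + 2 * (real (card X) * D)"
    using cost_le_split_wait[OF finite_X X_nonempty _ diameter, of "clock \<omega> n" ?\<rho>]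
      clock_mono[of n \<omega> _ n] pos
    by (simp add: request_seq_simps S Suc_le_eq)
  then have "ennreal (mpmd_cost d (request_seq n \<omega>) S) \<le>
      ennreal (2 * (\<Sum>i<n. ?\<rho> i + ?late i) + 2 * (real (card X) * D))"
    by (rule ennreal_leI)
  also have "\<dots> = ennreal (2 * (\<Sum>i<n. ?\<rho> i + ?late i)) + ennreal (2 * (real (card X) * D))"
    using radius_nonneg \<open>0 \<le> D\<close>
    by (intro ennreal_plus mult_nonneg_nonneg sum_nonneg add_nonneg_nonneg) auto
  also have "ennreal (2 * (\<Sum>i<n. ?\<rho> i + ?late i)) = 2 * (\<Sum>i<n. ennreal (?\<rho> i + ?late i))"
    using radius_nonneg by (subst sum_ennreal) (simp_all add: ennreal_mult')
  also have "\<dots> \<le> 2 * (\<Sum>i<n. ennreal (?\<rho> i) + near_overrun i n \<omega>)"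
    using wait by (intro mult_left_mono sum_mono) auto
  finally show ?thesis
    by (simp add: add_right_mono)
qed

lemma nn_integral_sum_near_overrun_le:
  "(\<integral>\<^sup>+\<omega>. (\<Sum>i<n. ennreal (critical_radius (snd (\<omega> i))) + near_overrun i n \<omega>) \<partial>arrivals n) \<le>
    ennreal (2 * real n * mean_radius)"
proof -
  note [measurable] = measurable_critical_radius measurable_near_overrun
  have "(\<integral>\<^sup>+\<omega>. (\<Sum>i<n. ennreal (critical_radius (snd (\<omega> i))) + near_overrun i n \<omega>) \<partial>arrivals n) =
      (\<Sum>i<n. \<integral>\<^sup>+\<omega>. ennreal (critical_radius (snd (\<omega> i))) + near_overrun i n \<omega> \<partial>arrivals n)"
    by (rule nn_integral_sum) simp
  also have "\<dots> \<le> (\<Sum>i<n. ennreal (2 * mean_radius))"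
  proof (intro sum_mono)
    fix i assume "i \<in> {..<n}"
    then have "(\<integral>\<^sup>+\<omega>. ennreal (critical_radius (snd (\<omega> i))) + near_overrun i n \<omega> \<partial>arrivals n) \<le>
        ennreal mean_radius + ennreal mean_radius"
      by (simp add: nn_integral_add nn_integral_critical_radius nn_integral_near_overrun_le
          add_left_mono)
    also have "\<dots> = ennreal (2 * mean_radius)"
      using mean_radius_pos by (simp flip: ennreal_plus)
    finally show "(\<integral>\<^sup>+\<omega>. ennreal (critical_radius (snd (\<omega> i))) + near_overrun i n \<omega>
        \<partial>arrivals n) \<le> ennreal (2 * mean_radius)" .
  qed
  also have "\<dots> = ennreal (\<Sum>i<n. 2 * mean_radius)"
    using mean_radius_pos by (intro sum_ennreal) simp
  finally show ?thesis
    by (simp add: mult_ac)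
qed

lemma expected_greedy_le:
  assumes "even n" and greedy: "\<And>\<sigma>. mpmd_input X \<sigma> \<Longrightarrow> greedy_solution d \<sigma> (Greedy \<sigma>)"
    and diameter: "\<And>x y. x \<in> X \<Longrightarrow> y \<in> X \<Longrightarrow> d x y \<le> D"
  shows "expected X rate n (\<lambda>\<sigma>. mpmd_cost d \<sigma> (Greedy \<sigma>)) \<le>
    ennreal (4 * real n * mean_radius) + ennreal (2 * (real (card X) * D))"
proof -
  let ?wait = "\<lambda>\<omega>. \<Sum>i<n. ennreal (critical_radius (snd (\<omega> i))) + near_overrun i n \<omega>"
  let ?C = "ennreal (2 * (real (card X) * D))"
  have "expected X rate n (\<lambda>\<sigma>. mpmd_cost d \<sigma> (Greedy \<sigma>)) \<le> (\<integral>\<^sup>+\<omega>. 2 * ?wait \<omega> + ?C \<partial>arrivals n)"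
    unfolding expected_def
  proof (rule nn_integral_mono_AE, rule AE_mp[OF AE_waiting_times_pos], intro AE_I2 impI)
    fix \<omega> assume "\<omega> \<in> space (arrivals n)" and "\<forall>k<n. 0 < fst (\<omega> k)"
    then show "ennreal (mpmd_cost d (request_seq n \<omega>) (Greedy (request_seq n \<omega>))) \<le>
        2 * ?wait \<omega> + ?C"
      using mpmd_input_request_seq \<open>even n\<close>
      by (intro greedy_cost_le_near_overrun greedy diameter) auto
  qed
  also have "\<dots> = 2 * (\<integral>\<^sup>+\<omega>. ?wait \<omega> \<partial>arrivals n) + ?C"
    using measurable_critical_radius measurable_near_overrun
    by (simp add: nn_integral_add nn_integral_cmult arrivals.emeasure_space_1)
  also have "\<dots> \<le> 2 * ennreal (2 * real n * mean_radius) + ?C"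
    by (intro add_right_mono mult_left_mono nn_integral_sum_near_overrun_le) simp
  also have "2 * ennreal (2 * real n * mean_radius) = ennreal (4 * real n * mean_radius)"
    using ennreal_mult'[of 2 "2 * real n * mean_radius"] by (simp add: mult.assoc)
  finally show ?thesis .
qed

section \<open>Expected optimal cost\<close>

abbreviation inner :: "'a \<Rightarrow> 'a set" where
  "inner x \<equiv> mball x (critical_radius x)"

abbreviation inner_clearance :: "nat \<Rightarrow> nat \<Rightarrow> (nat \<Rightarrow> real \<times> 'a) \<Rightarrow> ennreal" where
  "inner_clearance i n \<omega> \<equiv>
     clearance (inner (snd (\<omega> i))) i (critical_radius (snd (\<omega> i))) n \<omega>"

lemma measurable_inner_clearance: "i < n \<Longrightarrow> inner_clearance i n \<in> borel_measurable (arrivals n)"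
  using measurable_at_location[of "\<lambda>x. clearance (inner x) i (critical_radius x) n"]
  by simp

lemma nn_integral_inner_clearance_ge:
  assumes "i < n"
  shows "ennreal (mean_radius * ((1 - exp (-2)) / 2)) \<le> (\<integral>\<^sup>+\<omega>. inner_clearance i n \<omega> \<partial>arrivals n)"
proof -
  have "ennreal (mean_radius * ((1 - exp (-2)) / 2)) =
      (\<Sum>x\<in>X. ennreal (location.prob {x} * (critical_radius x * ((1 - exp (-2)) / 2))))"
    by (rule sum_location_critical_radius[symmetric]) simp
  also have "\<dots> \<le> (\<Sum>x\<in>X. \<integral>\<^sup>+\<omega>. of_bool (snd (\<omega> i) = x) *
      clearance (inner x) i (critical_radius x) n \<omega> \<partial>arrivals n)"
    using assms critical_radius_pos rate_mball_critical_radius_le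
    by (intro sum_mono nn_integral_clearance_ge mball_subset_mspace)
  also have "\<dots> = (\<integral>\<^sup>+\<omega>. inner_clearance i n \<omega> \<partial>arrivals n)"
    using assms by (intro nn_integral_by_location[symmetric]) auto
  finally show ?thesis .
qed

lemma inner_clearance_le_radius:
  assumes "\<omega> \<in> space (arrivals n)" "i < n"
  shows "inner_clearance i n \<omega> \<le> ennreal (critical_radius (snd (\<omega> i)))"
  using critical_radius_pos[OF space_arrivals[OF assms]] by (intro clearance_le) auto

lemma inner_clearance_le_dist:
  assumes \<omega>: "\<omega> \<in> space (arrivals n)" and pos: "\<And>k. k < n \<Longrightarrow> 0 < fst (\<omega> k)"
    and ij: "i < n" "j < n" "j \<noteq> i"
  shows "inner_clearance i n \<omega> \<le>
    ennreal (d (snd (\<omega> i)) (snd (\<omega> j)) + \<bar>clock \<omega> (Suc i) - clock \<omega> (Suc j)\<bar>)"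
proof (rule clearance_le)
  let ?x = "snd (\<omega> i)" and ?y = "snd (\<omega> j)"
  fix u assume u: "u \<le> critical_radius ?x" and isolated: "isolated (inner ?x) i n u \<omega>"
  show "u \<le> d ?x ?y + \<bar>clock \<omega> (Suc i) - clock \<omega> (Suc j)\<bar>"
  proof (cases "d ?x ?y < critical_radius ?x")
    case True
    then have "?y \<in> inner ?x"
      using space_arrivals[OF \<omega>] ij by simp
    then have "u < \<bar>clock \<omega> (Suc i) - clock \<omega> (Suc j)\<bar>"
      using isolated_arrival_gap[OF isolated ij _ pos] by simp
    then show ?thesis
      using nonneg[of ?x ?y] by linarith
  next
    case False
    then show ?thesis
      using u by linarith
  qed
qed simp

lemma sum_inner_clearance_le_OPT:
  assumes "even n" and \<omega>: "\<omega> \<in> space (arrivals n)" and pos: "\<And>k. k < n \<Longrightarrow> 0 < fst (\<omega> k)"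
  shows "ennreal (1 / 2) * (\<Sum>i<n. inner_clearance i n \<omega>) \<le> ennreal (OPT d (request_seq n \<omega>))"
proof -
  let ?\<sigma> = "request_seq n \<omega>"
  have finite: "ennreal (enn2real (inner_clearance i n \<omega>)) = inner_clearance i n \<omega>" if "i < n" for i
    using inner_clearance_le_radius[OF \<omega> that] ennreal_less_top le_less_trans
    by (intro ennreal_enn2real) blast
  have "(\<Sum>i<length ?\<sigma>. enn2real (inner_clearance i n \<omega>)) \<le> 2 * OPT d ?\<sigma>"
  proof (rule sum_le_twice_OPT)
    fix i j assume "i < length ?\<sigma>" "j < length ?\<sigma>" and "i \<noteq> j"
    then show "enn2real (inner_clearance i n \<omega>) \<le>
        d (loc ?\<sigma> i) (loc ?\<sigma> j) + \<bar>arr ?\<sigma> i - arr ?\<sigma> j\<bar>"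
      using inner_clearance_le_dist[OF \<omega> pos, of i j]
      by (intro enn2real_leI) (simp_all add: request_seq_simps)
  qed (use \<open>even n\<close> commute in \<open>auto simp: request_seq_simps\<close>)
  then have "ennreal (1 / 2 * (\<Sum>i<n. enn2real (inner_clearance i n \<omega>))) \<le> ennreal (OPT d ?\<sigma>)"
    by (intro ennreal_leI) (simp add: request_seq_simps)
  moreover have "(\<Sum>i<n. inner_clearance i n \<omega>) = ennreal (\<Sum>i<n. enn2real (inner_clearance i n \<omega>))"
    using finite by (simp flip: sum_ennreal)
  ultimately show ?thesis
    by (simp only: ennreal_mult' zero_le_divide_1_iff zero_le_numeral)
qed

lemma expected_OPT_ge:
  assumes "even n"
  shows "ennreal (real n * mean_radius * ((1 - exp (-2)) / 4)) \<le> expected X rate n (OPT d)"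
proof -
  have "ennreal (real n * mean_radius * ((1 - exp (-2)) / 4)) =
      ennreal (1 / 2) * (\<Sum>i<n. ennreal (mean_radius * ((1 - exp (-2)) / 2)))"
    by (simp add: ennreal_of_nat_eq_real_of_nat ennreal_mult'[symmetric] mult_ac del: ennreal_half)
  also have "\<dots> \<le> ennreal (1 / 2) * (\<Sum>i<n. \<integral>\<^sup>+\<omega>. inner_clearance i n \<omega> \<partial>arrivals n)"
    by (intro mult_left_mono sum_mono nn_integral_inner_clearance_ge) simp_all
  also have "(\<Sum>i<n. \<integral>\<^sup>+\<omega>. inner_clearance i n \<omega> \<partial>arrivals n) =
      (\<integral>\<^sup>+\<omega>. (\<Sum>i<n. inner_clearance i n \<omega>) \<partial>arrivals n)"
    by (intro nn_integral_sum[symmetric] measurable_inner_clearance) simp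
  also have "ennreal (1 / 2) * \<dots> =
      (\<integral>\<^sup>+\<omega>. ennreal (1 / 2) * (\<Sum>i<n. inner_clearance i n \<omega>) \<partial>arrivals n)"
    by (intro nn_integral_cmult[symmetric] borel_measurable_sum measurable_inner_clearance) simp
  also have "\<dots> \<le> expected X rate n (OPT d)"
    unfolding expected_def
  proof (rule nn_integral_mono_AE, rule AE_mp[OF AE_waiting_times_pos], intro AE_I2 impI)
    fix \<omega> assume "\<omega> \<in> space (arrivals n)" and "\<forall>k<n. 0 < fst (\<omega> k)"
    then show "ennreal (1 / 2) * (\<Sum>i<n. inner_clearance i n \<omega>) \<le> ennreal (OPT d (request_seq n \<omega>))"
      using assms by (intro sum_inner_clearance_le_OPT) auto
  qed
  finally show ?thesis .
qed

end

section \<open>The ratio of expectations\<close>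

theorem theorem1:
  fixes X :: "'a set" and d :: "'a \<Rightarrow> 'a \<Rightarrow> real" and rate :: "'a \<Rightarrow> real"
    and Greedy :: "'a requests \<Rightarrow> solution"
  assumes "Metric_space X d" and "finite X" and "X \<noteq> {}"
    and "\<And>x. x \<in> X \<Longrightarrow> rate x > 0"
    and "\<And>\<sigma>. mpmd_input X \<sigma> \<Longrightarrow> greedy_solution d \<sigma> (Greedy \<sigma>)"
  shows "limsup (\<lambda>k. expected X rate (2 * k) (\<lambda>\<sigma>. mpmd_cost d \<sigma> (Greedy \<sigma>))
                   / expected X rate (2 * k) (OPT d))
         \<le> ennreal (16 / (1 - exp (-2)))"
proof -
  interpret poisson_mpmd X d rate
    using assms by (simp add: poisson_mpmd_def poisson_arrival_process_def)
  define D where "D = (MAX p\<in>X \<times> X. d (fst p) (snd p))"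
  have diameter: "d x y \<le> D" if "x \<in> X" "y \<in> X" for x y
    unfolding D_def using finite_X that by (intro Max_ge) force+
  then have "0 \<le> D"
    using X_nonempty nonneg order_trans by blast
  then have "limsup (\<lambda>k. expected X rate (2 * k) (\<lambda>\<sigma>. mpmd_cost d \<sigma> (Greedy \<sigma>))
        / expected X rate (2 * k) (OPT d)) \<le>
      ennreal (8 * mean_radius / (mean_radius * (1 - exp (-2)) / 2))"
    using mean_radius_pos expected_OPT_ge[of "2 * _"]
      expected_greedy_le[OF _ assms(5) diameter, where n = "2 * _"]
    by (intro limsup_ratio_le[where C = "2 * (real (card X) * D)"]) (simp_all add: mult_ac)
  then show ?thesis
    using mean_radius_pos by simp
qed

end
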